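(* Let $X=\{X(t),\,t\ge 0\}$ and $\widehat X=\{\widehat X(t),\,t\ge 0\}$ be real-valued L\'evy processes, with $\widehat X$ non-trivial, such that, for some nonstochastic function $a(t)>0$ with $a(t)\to 0$ as $t\to 0$, $$\left\{\frac{X(ts)}{a(t)},\ s\ge 0\right\}\to\{\widehat X(s),\ s\ge 0\}\quad\text{as } t\to 0$$ in the sense of convergence of all finite-dimensional distributions. Let $H$ be the self-similarity index of $\widehat X$ and let $\beta^\infty$ be the index of the L\'evy measure of $X$ defined in the context. Then for $0<q<(1/H)\wedge\beta^\infty$ and every $s\ge0$, the family $\{a(t)^{-q}|X(ts)|^q\}$ is uniformly integrable as $t\to0$ (that is, over $t\in(0,t_0)$ for some $t_0>0$), and hence $$a(t)^{-q}\,\mathbb{E}|X(ts)|^q\to\mathbb{E}|\widehat X(s)|^q\quad\text{as }t\to0.$$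
   Context: A process is non-trivial if it is not identically $0$. Under the stated convergence with $\widehat X$ non-trivial, $\widehat X$ is self-similar with some index $H\ge 1/2$, i.e. for every $c>0$ the processes $\{\widehat X(ct),\,t\ge0\}$ and $\{c^H\widehat X(t),\,t\ge0\}$ have the same finite-dimensional distributions: $H=1/2$ if $\widehat X$ is Brownian motion, $H=1$ if $\widehat X$ is a nonzero linear drift, and $H=1/\alpha$ if $\widehat X$ is a strictly $\alpha$-stable L\'evy process with $0<\alpha<2$; these are the only possibilities. With $\Pi$ the L\'evy measure of $X$, $$\beta^\infty=\sup\left\{\beta\ge0:\int_{|x|>1}|x|^\beta\,\Pi(dx)<\infty\right\}\in[0,\infty].$$ *)

theory Defs
  imports "HOL-Probability.Probability"
begin

text \<open>
  Real-valued processes in continuous time are maps \<open>X :: real \<Rightarrow> 'a \<Rightarrow> real\<close>; only the values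
  \<open>X t\<close> with \<open>0 \<le> t\<close> are meaningful.
\<close>

locale levy_process = prob_space M
  for M :: "'a measure" and X :: "real \<Rightarrow> 'a \<Rightarrow> real" +
  assumes measurable_marginals: "0 \<le> t \<Longrightarrow> X t \<in> borel_measurable M"
    and starts_at_zero: "AE \<omega> in M. X 0 \<omega> = 0"
    and independent_increments:
      "0 \<le> u 0 \<Longrightarrow> (\<And>i. i < n \<Longrightarrow> u i \<le> u (Suc i)) \<Longrightarrow>
         indep_vars (\<lambda>_. borel) (\<lambda>i \<omega>. X (u (Suc i)) \<omega> - X (u i) \<omega>) {..<n::nat}"
    and stationary_increments:
      "0 \<le> s \<Longrightarrow> 0 \<le> t \<Longrightarrow>
         distr M borel (\<lambda>\<omega>. X (s + t) \<omega> - X s \<omega>) = distr M borel (X t)"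
    and stochastically_continuous:
      "0 \<le> t \<Longrightarrow> 0 < \<epsilon> \<Longrightarrow>
         ((\<lambda>s. prob {\<omega> \<in> space M. \<epsilon> < \<bar>X s \<omega> - X t \<omega>\<bar>}) \<longlongrightarrow> 0) (at t within {0..})"
    and cadlag_paths:
      "AE \<omega> in M. (\<forall>t\<ge>0. ((\<lambda>s. X s \<omega>) \<longlongrightarrow> X t \<omega>) (at_right t)) \<and>
                   (\<forall>t>0. \<exists>l. ((\<lambda>s. X s \<omega>) \<longlongrightarrow> l) (at_left t))"

definition nontrivial_process :: "'a measure \<Rightarrow> (real \<Rightarrow> 'a \<Rightarrow> real) \<Rightarrow> bool" where
  "nontrivial_process M X \<longleftrightarrow> \<not> (\<forall>t\<ge>0. AE \<omega> in M. X t \<omega> = 0)"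

text \<open>Joint law of \<open>(X t)\<close>, \<open>t \<in> I\<close>.\<close>

definition fdd :: "'a measure \<Rightarrow> (real \<Rightarrow> 'a \<Rightarrow> real) \<Rightarrow> real set \<Rightarrow> (real \<Rightarrow> real) measure" where
  "fdd M X I = distr M (\<Pi>\<^sub>M t\<in>I. borel) (\<lambda>\<omega>. \<lambda>t\<in>I. X t \<omega>)"

definition same_fdds ::
  "'a measure \<Rightarrow> (real \<Rightarrow> 'a \<Rightarrow> real) \<Rightarrow> 'b measure \<Rightarrow> (real \<Rightarrow> 'b \<Rightarrow> real) \<Rightarrow> bool" where
  "same_fdds M X N Y \<longleftrightarrow> (\<forall>I. finite I \<and> I \<subseteq> {0..} \<longrightarrow> fdd M X I = fdd N Y I)"

text \<open>
  Weak convergence of the joint laws at finitely many times, tested on bounded continuous functions.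
  For finite \<open>I\<close> the extensional functions \<open>I \<rightarrow>\<^sub>E UNIV\<close>, with the topology of pointwise
  convergence, are a copy of Euclidean space with coordinates indexed by \<open>I\<close>.
\<close>

definition fdd_convergence ::
  "'a measure \<Rightarrow> (real \<Rightarrow> real \<Rightarrow> 'a \<Rightarrow> real) \<Rightarrow> 'b measure \<Rightarrow> (real \<Rightarrow> 'b \<Rightarrow> real) \<Rightarrow> real filter \<Rightarrow> bool"
  where
  "fdd_convergence M Y N Z F \<longleftrightarrow>
     (\<forall>I. finite I \<and> I \<subseteq> {0..} \<longrightarrow>
       (\<forall>f :: (real \<Rightarrow> real) \<Rightarrow> real.
          continuous_on (I \<rightarrow>\<^sub>E UNIV) f \<and> bounded (f ` (I \<rightarrow>\<^sub>E UNIV)) \<longrightarrow>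
          ((\<lambda>t. \<integral>x. f x \<partial>fdd M (Y t) I) \<longlongrightarrow> (\<integral>x. f x \<partial>fdd N Z I)) F))"

definition self_similar :: "'a measure \<Rightarrow> (real \<Rightarrow> 'a \<Rightarrow> real) \<Rightarrow> real \<Rightarrow> bool" where
  "self_similar M X H \<longleftrightarrow>
     (\<forall>c>0. same_fdds M (\<lambda>t. X (c * t)) M (\<lambda>t \<omega>. c powr H * X t \<omega>))"

text \<open>
  \<open>\<nu>\<close> is the Levy measure of \<open>X\<close>, as given by the Levy-Khintchine formula with drift \<open>b\<close> and
  Gaussian variance \<open>v\<close>.
\<close>

definition levy_measure :: "'a measure \<Rightarrow> (real \<Rightarrow> 'a \<Rightarrow> real) \<Rightarrow> real measure \<Rightarrow> bool" where
  "levy_measure M X \<nu> \<longleftrightarrow>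
     sets \<nu> = sets borel \<and> emeasure \<nu> {0} = 0 \<and> (\<integral>\<^sup>+x. ennreal (min 1 (x\<^sup>2)) \<partial>\<nu>) < \<infinity> \<and>
     (\<exists>b v. 0 \<le> v \<and>
       (\<forall>t\<ge>0. \<forall>\<theta>. char (distr M borel (X t)) \<theta> =
          exp (complex_of_real t *
            (\<i> * complex_of_real (b * \<theta>) - complex_of_real (v * \<theta>\<^sup>2 / 2) +
             (CLINT x|\<nu>. (iexp (\<theta> * x) - 1 - \<i> * complex_of_real (\<theta> * x * indicator {-1..1} x)))))))"

definition beta_infty :: "real measure \<Rightarrow> ereal" where
  "beta_infty \<nu> =
     Sup {ereal \<beta> |\<beta>. 0 \<le> \<beta> \<and> (\<integral>\<^sup>+x\<in>{x. 1 < \<bar>x\<bar>}. ennreal (\<bar>x\<bar> powr \<beta>) \<partial>\<nu>) < \<infinity>}"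

definition uniformly_integrable :: "'a measure \<Rightarrow> ('i \<Rightarrow> 'a \<Rightarrow> real) \<Rightarrow> 'i set \<Rightarrow> bool" where
  "uniformly_integrable M Y T \<longleftrightarrow>
     (\<forall>i\<in>T. Y i \<in> borel_measurable M) \<and>
     ((\<lambda>K::real. SUP i\<in>T. \<integral>\<^sup>+\<omega>\<in>{\<omega>. K < \<bar>Y i \<omega>\<bar>}. ennreal \<bar>Y i \<omega>\<bar> \<partial>M) \<longlongrightarrow> 0) at_top"

end

theory Submission
  imports Defs
begin

text \<open>
  Write \<open>\<psi>\<close> for the Levy exponent, so that \<open>X t\<close> has characteristic function \<open>exp (t * \<psi> \<theta>)\<close>,
  and \<open>g = - Re \<psi> \<ge> 0\<close>. Everything follows from one estimate, for some \<open>\<beta> > q\<close>: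
  \<open>t * g (\<theta> / a t) \<le> C * \<theta> powr \<beta>\<close> for all \<open>0 \<le> \<theta> \<le> \<theta>0\<close> and all small \<open>t\<close>
  (\<open>exponent_powr_bound\<close>). The left-hand side is minus the real part of the exponent of \<open>X t / a t\<close>,
  so the estimate bounds \<open>1 - \<bar>char\<bar>\<^sup>2\<close> near the origin uniformly in \<open>t\<close>. Now \<open>1 - \<bar>char\<bar>\<^sup>2\<close> is the mean of
  \<open>1 - cos (\<theta> * Y)\<close> for the symmetrization \<open>Y\<close> of \<open>X t / a t\<close>; summing these quantities over the
  dyadic frequencies \<open>\<theta>0 / 2 ^ n\<close> with weights \<open>(\<theta>0 / 2 ^ n) powr (- p)\<close> bounds the moment of
  order \<open>p\<close> of \<open>Y\<close> for any \<open>p < \<beta>\<close>, and tightness removes the symmetrization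
  (\<open>moment_bound_from_char\<close>). With \<open>q < p < \<beta>\<close> this gives uniform integrability of the powers
  of order \<open>q\<close>, and, by truncation, convergence of the moments (\<open>moment_convergence\<close>).

  The estimate on the exponent is obtained by descending from one fixed scale \<open>t \<approx> t0\<close> to \<open>0\<close>.
  At the fixed scale, \<open>a\<close> is bounded below and \<open>g \<theta> = O(\<bar>\<theta>\<bar> powr \<beta>)\<close> on bounded sets
  because \<open>\<nu>\<close> has a finite tail moment of order \<open>\<beta> \<le> 2\<close>; this is where \<open>q < beta_infty \<nu>\<close> enters.
  From \<open>2 * t\<close> to \<open>t\<close>, the exponent gains a factor \<open>1/2\<close>, while the frequency is rescaled by
  \<open>a (2 * t) / a t\<close>, which is eventually at most \<open>2 powr (1 / \<beta>)\<close> because \<open>H < 1 / \<beta>\<close>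
  (\<open>norming_ratio_le\<close>); raised to the power \<open>\<beta>\<close> this costs a factor at most \<open>2\<close>, and the two
  cancel. This is where \<open>q < 1 / H\<close> enters.

  Two auxiliary facts are proved by the same contradiction, namely that \<open>u n * \<psi> (\<theta> / a (u n)) \<rightarrow> 0\<close>
  along a sequence \<open>u n \<rightarrow> 0\<close> would force the limit process to vanish
  (\<open>exponent_not_vanishing\<close>): the lower bound of \<open>a\<close> at the fixed scale, and \<open>H \<ge> 1/2\<close>, which
  yields \<open>\<beta> < 1 / H \<le> 2\<close>.
\<close>

section \<open>Moments from the characteristic function near the origin\<close>

lemma one_minus_cos_ge:
  fixes u :: real assumes "1/2 \<le> \<bar>u\<bar>" "\<bar>u\<bar> \<le> 1" shows "1/16 \<le> 1 - cos u"
proof -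
  have "cmod (iexp u - (\<Sum>k\<le>3. (\<i> * u) ^ k / fact k)) \<le> \<bar>u\<bar> ^ Suc 3 / fact (Suc 3)"
    by (rule iexp_approx1)
  then have b: "\<bar>Re (iexp u - (\<Sum>k\<le>3. (\<i> * u) ^ k / fact k))\<bar> \<le> \<bar>u\<bar> ^ 4 / 24"
    by (rule order_trans[OF abs_Re_le_cmod order_trans]) (simp add: numeral_eq_Suc fact_numeral)
  have "Re (iexp u - (\<Sum>k\<le>3. (\<i> * u) ^ k / fact k)) = cos u - 1 + u\<^sup>2 / 2"
    by (simp add: numeral_eq_Suc fact_numeral Re_exp)
  with b have "cos u \<le> 1 - u\<^sup>2/2 + \<bar>u\<bar>^4/24" by linarith
  moreover have "\<bar>u\<bar>^4 \<le> u\<^sup>2" 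
  proof -
    have "\<bar>u\<bar>^4 \<le> \<bar>u\<bar>^2" by (rule power_decreasing) (use assms in auto)
    then show ?thesis by simp
  qed
  moreover have "1/4 \<le> u\<^sup>2" 
  proof -
    have "(1/2)^2 \<le> \<bar>u\<bar>^2" by (rule power_mono) (use assms in auto)
    then show ?thesis by (simp add: power2_eq_square)
  qed
  ultimately show ?thesis by linarith
qed

lemma one_minus_cos_le_powr:
  fixes u \<beta> :: real assumes "0 \<le> \<beta>" "\<beta> \<le> 2" shows "1 - cos u \<le> 2 * \<bar>u\<bar> powr \<beta>"
proof (cases "\<bar>u\<bar> \<le> 1")
  case True
  have "cmod (iexp u - (\<Sum>k\<le>1. (\<i> * u) ^ k / fact k)) \<le> \<bar>u\<bar> ^ Suc 1 / fact (Suc 1)"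
    by (rule iexp_approx1)
  then have b: "\<bar>Re (iexp u - (\<Sum>k\<le>1. (\<i> * u) ^ k / fact k))\<bar> \<le> u\<^sup>2 / 2"
    by (rule order_trans[OF abs_Re_le_cmod order_trans]) (simp add: power2_eq_square)
  have "Re (iexp u - (\<Sum>k\<le>1. (\<i> * u) ^ k / fact k)) = cos u - 1"
    by (simp add: Re_exp)
  with b have 1: "1 - cos u \<le> u\<^sup>2 / 2" by linarith
  show ?thesis
  proof (cases "u = 0")
    case False
    then have "u\<^sup>2 = \<bar>u\<bar> powr 2" by simp
    also have "\<dots> \<le> \<bar>u\<bar> powr \<beta>"
      by (rule powr_mono') (use assms True in auto)
    finally have "u\<^sup>2 \<le> \<bar>u\<bar> powr \<beta>" .
    with 1 show ?thesis using zero_le_power2[of u] by linarith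
  qed simp
next
  case False
  then have "1 \<le> \<bar>u\<bar> powr \<beta>" using assms by (simp add: ge_one_powr_ge_zero)
  then show ?thesis using cos_ge_minus_one[of u] by linarith
qed

text \<open>
  If \<open>\<bar>z\<bar>\<close> is large, exactly one dyadic frequency \<open>\<theta>\<close> brings \<open>\<theta> * \<bar>z\<bar>\<close> into the interval
  \<open>(1/2, 1]\<close>. There \<open>1 - cos (\<theta> * z) \<ge> 1/16\<close> and \<open>\<theta> powr (- q) \<ge> \<bar>z\<bar> powr q\<close>, so this single
  term of the series dominates. The sum over dyadic frequencies takes the place of the classical
  integral of \<open>(1 - cos (\<theta> * z)) * \<theta> powr (- 1 - q)\<close>.
\<close>

lemma powr_le_dyadic_cos_series:
  fixes q \<theta>0 z :: real
  assumes q: "0 < q" and \<theta>0: "0 < \<theta>0"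
  shows "ennreal (\<bar>z\<bar> powr q) \<le> ennreal (\<theta>0 powr (- q)) +
           (\<Sum>n. ennreal (16 * (\<theta>0 / 2 ^ n) powr (- q)) * ennreal (1 - cos (\<theta>0 / 2 ^ n * z)))"
proof (cases "\<theta>0 * \<bar>z\<bar> \<le> 1")
  case True
  have "\<bar>z\<bar> powr q \<le> (1 / \<theta>0) powr q"
    by (rule powr_mono2) (use assms True in \<open>auto simp: field_simps\<close>)
  also have "\<dots> = \<theta>0 powr (- q)" using \<theta>0 by (simp add: powr_divide powr_minus_divide)
  finally show ?thesis by (simp add: add_increasing2 ennreal_leI)
next
  case False
  \<comment> \<open>By minimality, the first dyadic frequency with \<open>\<theta> * \<bar>z\<bar> \<le> 1\<close> still satisfies
    \<open>\<theta> * \<bar>z\<bar> \<ge> 1/2\<close>.\<close>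
  define n where "n = (LEAST n. \<theta>0 / 2 ^ n * \<bar>z\<bar> \<le> 1)"
  obtain m where "\<theta>0 * \<bar>z\<bar> < 2 ^ m" using real_arch_pow[of 2 "\<theta>0 * \<bar>z\<bar>"] by auto
  then have ex: "\<theta>0 / 2 ^ m * \<bar>z\<bar> \<le> 1" by (simp add: field_simps)
  have n1: "\<theta>0 / 2 ^ n * \<bar>z\<bar> \<le> 1" unfolding n_def by (rule LeastI[where P="\<lambda>n. \<theta>0 / 2 ^ n * \<bar>z\<bar> \<le> 1", OF ex])
  have "n \<noteq> 0" using False n1 by (cases n) auto
  then obtain k where k: "n = Suc k" using not0_implies_Suc by blast
  have "\<not> \<theta>0 / 2 ^ k * \<bar>z\<bar> \<le> 1"
    using not_less_Least[of k "\<lambda>n. \<theta>0 / 2 ^ n * \<bar>z\<bar> \<le> 1"] k unfolding n_def by auto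
  then have n2: "1/2 \<le> \<theta>0 / 2 ^ n * \<bar>z\<bar>" using k by simp
  have c: "1/16 \<le> 1 - cos (\<theta>0 / 2 ^ n * z)"
    by (rule one_minus_cos_ge) (use n1 n2 \<theta>0 in \<open>auto simp: abs_mult\<close>)
  have "\<bar>z\<bar> powr q \<le> (1 / (\<theta>0 / 2 ^ n)) powr q"
    by (rule powr_mono2) (use assms n1 in \<open>auto simp: field_simps\<close>)
  also have "\<dots> = (\<theta>0 / 2 ^ n) powr (- q)" using \<theta>0 by (simp add: powr_divide powr_minus_divide)
  also have "\<dots> \<le> 16 * (\<theta>0 / 2 ^ n) powr (- q) * (1 - cos (\<theta>0 / 2 ^ n * z))"
    using mult_left_mono[OF c, of "16 * (\<theta>0 / 2 ^ n) powr (- q)"] by simp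
  finally have "ennreal (\<bar>z\<bar> powr q) \<le>
      ennreal (16 * (\<theta>0 / 2 ^ n) powr (- q)) * ennreal (1 - cos (\<theta>0 / 2 ^ n * z))"
    by (simp add: ennreal_leI flip: ennreal_mult')
  also have "\<dots> \<le> (\<Sum>n. ennreal (16 * (\<theta>0 / 2 ^ n) powr (- q)) * ennreal (1 - cos (\<theta>0 / 2 ^ n * z)))"
    using sum_le_suminf[of "\<lambda>n. ennreal (16 * (\<theta>0 / 2 ^ n) powr (- q)) * ennreal (1 - cos (\<theta>0 / 2 ^ n * z))" "{n}"]
    by simp
  finally show ?thesis by (simp add: add_increasing)
qed

lemma (in real_distribution) char_eq_cos_sin:
  "char M \<theta> = Complex (\<integral>x. cos (\<theta> * x) \<partial>M) (\<integral>x. sin (\<theta> * x) \<partial>M)"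
proof -
  have i: "integrable M (\<lambda>x. iexp (\<theta> * x))" by (rule integrable_iexp) auto
  show ?thesis unfolding char_def
    using integral_Re[OF i] integral_Im[OF i]
    by (simp add: complex_eq_iff Re_exp Im_exp)
qed

text \<open>
  The squared modulus of a characteristic function is the characteristic function of the
  difference of two independent copies. The double integral expresses this without
  constructing the copies.
\<close>

lemma (in real_distribution) symmetrized_cos_integral:
  "(\<integral>\<^sup>+x. \<integral>\<^sup>+y. ennreal (1 - cos (\<theta> * (x - y))) \<partial>M \<partial>M) = ennreal (1 - (cmod (char M \<theta>))\<^sup>2)"
proof -
  have p1: "prob UNIV = 1" using prob_space by (simp only: space_eq_univ)
  define A where "A = (\<integral>x. cos (\<theta> * x) \<partial>M)"
  define B where "B = (\<integral>x. sin (\<theta> * x) \<partial>M)"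
  have ic: "integrable M (\<lambda>x. cos (\<theta> * x))" and isn: "integrable M (\<lambda>x. sin (\<theta> * x))"
    by (auto intro!: integrable_const_bound[where B=1])
  have inner: "(\<integral>\<^sup>+y. ennreal (1 - cos (\<theta> * (x - y))) \<partial>M)
      = ennreal (1 - (cos (\<theta> * x) * A + sin (\<theta> * x) * B))" for x
  proof -
    have e: "1 - cos (\<theta> * (x - y)) = 1 - (cos (\<theta> * x) * cos (\<theta> * y) + sin (\<theta> * x) * sin (\<theta> * y))" for y
      by (simp add: right_diff_distrib cos_diff)
    have "(\<integral>\<^sup>+y. ennreal (1 - cos (\<theta> * (x - y))) \<partial>M) = ennreal (\<integral>y. 1 - cos (\<theta> * (x - y)) \<partial>M)"
      by (rule nn_integral_eq_integral) (use ic isn in \<open>auto intro!: integrable_const_bound[where B=2] simp: abs_le_iff\<close>)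
    then show ?thesis using ic isn by (simp add: e A_def B_def p1)
  qed
  have pos: "0 \<le> 1 - (cos (\<theta> * x) * A + sin (\<theta> * x) * B)" for x
  proof -
    have "(\<integral>y. cos (\<theta> * (x - y)) \<partial>M) \<le> (\<integral>y. 1 \<partial>M)"
      by (rule integral_mono) (auto intro!: integrable_const_bound[where B=1])
    then have "(\<integral>y. cos (\<theta> * x) * cos (\<theta> * y) + sin (\<theta> * x) * sin (\<theta> * y) \<partial>M) \<le> 1"
      by (simp add: right_diff_distrib cos_diff p1)
    then show ?thesis using ic isn by (simp add: A_def B_def)
  qed
  have ch: "char M \<theta> = Complex A B"
    unfolding A_def B_def by (rule char_eq_cos_sin)
  have "(\<integral>\<^sup>+x. \<integral>\<^sup>+y. ennreal (1 - cos (\<theta> * (x - y))) \<partial>M \<partial>M)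
      = ennreal (\<integral>x. 1 - (cos (\<theta> * x) * A + sin (\<theta> * x) * B) \<partial>M)"
    unfolding inner by (rule nn_integral_eq_integral) (use ic isn pos in auto)
  also have "(\<integral>x. 1 - (cos (\<theta> * x) * A + sin (\<theta> * x) * B) \<partial>M) = 1 - (A * A + B * B)"
    using ic isn by (simp add: p1 A_def[symmetric] B_def[symmetric])
  also have "\<dots> = 1 - (cmod (char M \<theta>))\<^sup>2"
    unfolding ch by (simp add: cmod_def power2_eq_square)
  finally show ?thesis .
qed

lemma abs_powr_add_le:
  fixes x y q :: real assumes "0 < q"
  shows "\<bar>x + y\<bar> powr q \<le> 2 powr q * (\<bar>x\<bar> powr q + \<bar>y\<bar> powr q)"
proof -
  have "\<bar>x + y\<bar> powr q \<le> (2 * max \<bar>x\<bar> \<bar>y\<bar>) powr q"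
    by (rule powr_mono2) (use assms in auto)
  also have "\<dots> = 2 powr q * (max \<bar>x\<bar> \<bar>y\<bar>) powr q" by (simp add: powr_mult)
  also have "\<dots> \<le> 2 powr q * (\<bar>x\<bar> powr q + \<bar>y\<bar> powr q)"
    by (rule mult_left_mono) (auto simp: max_def)
  finally show ?thesis .
qed

text \<open>
  The bound \<open>B\<close> does not depend on the law \<open>\<mu>\<close>, only on the decay of \<open>1 - \<bar>char\<bar>\<^sup>2\<close> at the
  origin and on a quantile: this uniformity is what the small-time limit needs.
  The series of \<open>powr_le_dyadic_cos_series\<close> is integrated termwise against the symmetrized law
  and becomes geometric with ratio \<open>2 powr (q - \<beta>)\<close>. Since the independent copy
  \<open>y\<close> lies in \<open>[-R, R]\<close> with probability at least \<open>1/2\<close>, half of the moment of \<open>x\<close> is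
  controlled by the moment of \<open>x - y\<close>, up to a constant.
\<close>

lemma moment_bound_from_char:
  fixes q \<beta> \<theta>0 C R :: real
  assumes q: "0 < q" "q < \<beta>" and \<theta>0: "0 < \<theta>0" and C: "0 \<le> C"
  obtains B where "0 \<le> B"
    "\<And>\<mu>. \<lbrakk>real_distribution \<mu>;
          \<And>\<theta>. \<lbrakk>0 < \<theta>; \<theta> \<le> \<theta>0\<rbrakk> \<Longrightarrow> 1 - (cmod (char \<mu> \<theta>))\<^sup>2 \<le> C * \<theta> powr \<beta>;
          1/2 \<le> measure \<mu> {x. \<bar>x\<bar> \<le> R}\<rbrakk>
        \<Longrightarrow> (\<integral>\<^sup>+x. ennreal (\<bar>x\<bar> powr q) \<partial>\<mu>) \<le> ennreal B"
proof -
  define r :: real where "r = 2 powr (q - \<beta>)"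
  have r: "0 < r" "r < 1" using q unfolding r_def by (auto simp: powr_less_one)
  define S where "S = (\<Sum>n. 16 * C * \<theta>0 powr (\<beta> - q) * r ^ n)"
  have sm: "summable (\<lambda>n. 16 * C * \<theta>0 powr (\<beta> - q) * r ^ n)"
    using r by (intro summable_mult summable_geometric) auto
  have S0: "0 \<le> S" unfolding S_def using sm by (rule suminf_nonneg) (use C r in auto)
  define B where "B = 2 * (2 powr q * ((\<theta>0 powr (- q) + S) + \<bar>R\<bar> powr q))"
  show ?thesis
  proof
    show "0 \<le> B" unfolding B_def using S0 by simp
    fix \<mu> :: "real measure"
    assume \<mu>: "real_distribution \<mu>"
      and ch: "\<And>\<theta>. \<lbrakk>0 < \<theta>; \<theta> \<le> \<theta>0\<rbrakk> \<Longrightarrow> 1 - (cmod (char \<mu> \<theta>))\<^sup>2 \<le> C * \<theta> powr \<beta>"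
      and R: "1/2 \<le> measure \<mu> {x. \<bar>x\<bar> \<le> R}"
    interpret real_distribution \<mu> by fact
    let ?w = "\<lambda>n. ennreal (16 * (\<theta>0 / 2 ^ n) powr (- q))"
    have "(\<integral>\<^sup>+x. \<integral>\<^sup>+y. ennreal (\<bar>x - y\<bar> powr q) \<partial>\<mu> \<partial>\<mu>)
      \<le> (\<integral>\<^sup>+x. \<integral>\<^sup>+y. (ennreal (\<theta>0 powr (- q)) +
           (\<Sum>n. ?w n * ennreal (1 - cos (\<theta>0 / 2 ^ n * (x - y))))) \<partial>\<mu> \<partial>\<mu>)"
      by (intro nn_integral_mono powr_le_dyadic_cos_series q \<theta>0)
    also have "\<dots> = ennreal (\<theta>0 powr (- q)) +
        (\<Sum>n. ?w n * (\<integral>\<^sup>+x. \<integral>\<^sup>+y. ennreal (1 - cos (\<theta>0 / 2 ^ n * (x - y))) \<partial>\<mu> \<partial>\<mu>))"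
      by (simp add: nn_integral_add nn_integral_suminf nn_integral_cmult emeasure_space_1
            del: space_eq_univ)
    also have "\<dots> \<le> ennreal (\<theta>0 powr (- q)) + (\<Sum>n. ennreal (16 * C * \<theta>0 powr (\<beta> - q) * r ^ n))"
    proof (intro add_mono order_refl suminf_le summableI)
      fix n
      have t: "0 < \<theta>0 / 2 ^ n" "\<theta>0 / 2 ^ n \<le> \<theta>0" using \<theta>0 by (auto simp: field_simps)
      have "(\<theta>0 / 2 ^ n) powr (- q) * (\<theta>0 / 2 ^ n) powr \<beta> = (\<theta>0 / 2 ^ n) powr (\<beta> - q)"
        by (simp flip: powr_add)
      also have "\<dots> = \<theta>0 powr (\<beta> - q) * r ^ n"
        using \<theta>0 unfolding r_def
        by (simp add: powr_divide powr_powr powr_minus_divide flip: powr_realpow)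
           (simp add: powr_minus_divide[symmetric] divide_inverse powr_minus[symmetric] algebra_simps)
      finally have e: "(\<theta>0 / 2 ^ n) powr (- q) * (\<theta>0 / 2 ^ n) powr \<beta> = \<theta>0 powr (\<beta> - q) * r ^ n" .
      have "?w n * (\<integral>\<^sup>+x. \<integral>\<^sup>+y. ennreal (1 - cos (\<theta>0 / 2 ^ n * (x - y))) \<partial>\<mu> \<partial>\<mu>)
         = ?w n * ennreal (1 - (cmod (char \<mu> (\<theta>0 / 2 ^ n)))\<^sup>2)"
        by (simp only: symmetrized_cos_integral)
      also have "\<dots> \<le> ?w n * ennreal (C * (\<theta>0 / 2 ^ n) powr \<beta>)"
        by (intro mult_left_mono ennreal_leI ch t) auto
      also have "\<dots> = ennreal (16 * C * ((\<theta>0 / 2 ^ n) powr (- q) * (\<theta>0 / 2 ^ n) powr \<beta>))"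
        using C by (simp add: ennreal_mult'[symmetric] mult_ac)
      finally show "?w n * (\<integral>\<^sup>+x. \<integral>\<^sup>+y. ennreal (1 - cos (\<theta>0 / 2 ^ n * (x - y))) \<partial>\<mu> \<partial>\<mu>)
          \<le> ennreal (16 * C * \<theta>0 powr (\<beta> - q) * r ^ n)"
        by (simp only: e mult.assoc)
    qed
    also have "\<dots> = ennreal (\<theta>0 powr (- q) + S)"
      unfolding S_def using sm r C S0 by (subst suminf_ennreal2) (auto simp: S_def)
    finally have symmetrized: "(\<integral>\<^sup>+x. \<integral>\<^sup>+y. ennreal (\<bar>x - y\<bar> powr q) \<partial>\<mu> \<partial>\<mu>) \<le> ennreal (\<theta>0 powr (- q) + S)" .
    have "ennreal (1/2) * (\<integral>\<^sup>+x. ennreal (\<bar>x\<bar> powr q) \<partial>\<mu>)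
        \<le> emeasure \<mu> {y. \<bar>y\<bar> \<le> R} * (\<integral>\<^sup>+x. ennreal (\<bar>x\<bar> powr q) \<partial>\<mu>)"
      by (intro mult_right_mono) (simp_all only: emeasure_eq_measure ennreal_leI[OF R] zero_le)
    also have "\<dots> = (\<integral>\<^sup>+x. \<integral>\<^sup>+y. ennreal (\<bar>x\<bar> powr q) * indicator {y. \<bar>y\<bar> \<le> R} y \<partial>\<mu> \<partial>\<mu>)"
      by (simp add: nn_integral_cmult nn_integral_multc mult.commute)
    also have "\<dots> \<le> (\<integral>\<^sup>+x. \<integral>\<^sup>+y. ennreal (2 powr q) * (ennreal (\<bar>x - y\<bar> powr q) + ennreal (\<bar>R\<bar> powr q)) \<partial>\<mu> \<partial>\<mu>)"
    proof (intro nn_integral_mono)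
      fix x y
      show "ennreal (\<bar>x\<bar> powr q) * indicator {y. \<bar>y\<bar> \<le> R} y
          \<le> ennreal (2 powr q) * (ennreal (\<bar>x - y\<bar> powr q) + ennreal (\<bar>R\<bar> powr q))"
      proof (cases "\<bar>y\<bar> \<le> R")
        case True
        have "\<bar>x\<bar> powr q \<le> 2 powr q * (\<bar>x - y\<bar> powr q + \<bar>y\<bar> powr q)"
          using abs_powr_add_le[OF q(1), of "x - y" y] by simp
        also have "\<dots> \<le> 2 powr q * (\<bar>x - y\<bar> powr q + \<bar>R\<bar> powr q)"
          using True q by (intro mult_left_mono add_left_mono powr_mono2) auto
        finally show ?thesis using True
          by (simp add: ennreal_plus[symmetric] ennreal_mult'[symmetric] ennreal_leI del: ennreal_plus)
      qed auto
    qed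
    also have "\<dots> = ennreal (2 powr q) * ((\<integral>\<^sup>+x. \<integral>\<^sup>+y. ennreal (\<bar>x - y\<bar> powr q) \<partial>\<mu> \<partial>\<mu>) + ennreal (\<bar>R\<bar> powr q))"
      by (simp add: nn_integral_add nn_integral_cmult emeasure_space_1 del: space_eq_univ)
    also have "\<dots> \<le> ennreal (2 powr q) * (ennreal (\<theta>0 powr (- q) + S) + ennreal (\<bar>R\<bar> powr q))"
      by (intro mult_left_mono add_right_mono symmetrized) auto
    also have "\<dots> = ennreal (B / 2)"
      unfolding B_def using S0 by (simp add: ennreal_plus[symmetric] ennreal_mult'[symmetric] del: ennreal_plus)
    finally have "ennreal (1/2) * (\<integral>\<^sup>+x. ennreal (\<bar>x\<bar> powr q) \<partial>\<mu>) \<le> ennreal (B / 2)" .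
    then have "ennreal 2 * (ennreal (1/2) * (\<integral>\<^sup>+x. ennreal (\<bar>x\<bar> powr q) \<partial>\<mu>)) \<le> ennreal 2 * ennreal (B / 2)"
      by (rule mult_left_mono) auto
    then show "(\<integral>\<^sup>+x. ennreal (\<bar>x\<bar> powr q) \<partial>\<mu>) \<le> ennreal B"
      by (simp only: mult.assoc[symmetric] ennreal_mult'[symmetric]) simp
  qed
qed

section \<open>The Levy exponent\<close>

definition levy_exponent :: "real \<Rightarrow> real \<Rightarrow> real measure \<Rightarrow> real \<Rightarrow> complex" where
  "levy_exponent b v \<nu> \<theta> = \<i> * complex_of_real (b * \<theta>) - complex_of_real (v * \<theta>\<^sup>2 / 2) +
     (CLINT x|\<nu>. (iexp (\<theta> * x) - 1 - \<i> * complex_of_real (\<theta> * x * indicator {-1..1} x)))"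

locale levy_triplet =
  fixes b v :: real and \<nu> :: "real measure"
  assumes sets_nu: "sets \<nu> = sets borel"
    and nu_integrable: "(\<integral>\<^sup>+x. ennreal (min 1 (x\<^sup>2)) \<partial>\<nu>) < \<infinity>"
    and v_nonneg: "0 \<le> v"
begin

declare sets_nu [measurable_cong]

abbreviation \<psi> :: "real \<Rightarrow> complex" where "\<psi> \<equiv> levy_exponent b v \<nu>"

definition kernel :: "real \<Rightarrow> real \<Rightarrow> complex" where
  "kernel \<theta> x = iexp (\<theta> * x) - 1 - \<i> * complex_of_real (\<theta> * x * indicator {-1..1} x)"

lemma kernel_measurable [measurable]: "kernel \<theta> \<in> borel_measurable borel"
  unfolding kernel_def by measurable

lemma integrable_min: "integrable \<nu> (\<lambda>x. min 1 (x\<^sup>2))"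
  by (rule integrableI_nonneg) (use nu_integrable in auto)

text \<open>
  The compensator \<open>\<i> * \<theta> * x\<close> makes the integrand of order \<open>x\<^sup>2\<close> near \<open>0\<close>; away from \<open>0\<close>
  it is bounded by \<open>2\<close>. The domination is locally uniform in \<open>\<theta>\<close>, which gives continuity
  of \<open>\<psi>\<close>, and grows only quadratically in \<open>\<theta>\<close>.
\<close>

lemma cmod_kernel_le: "cmod (kernel \<theta> x) \<le> (2 + \<theta>\<^sup>2) * min 1 (x\<^sup>2)"
proof (cases "\<bar>x\<bar> \<le> 1")
  case True
  have "cmod (iexp (\<theta> * x) - (\<Sum>k\<le>1. (\<i> * (\<theta> * x)) ^ k / fact k)) \<le> \<bar>\<theta> * x\<bar> ^ Suc 1 / fact (Suc 1)"
    using iexp_approx1[of "\<theta> * x" 1] by simp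
  then have "cmod (kernel \<theta> x) \<le> (\<theta> * x)\<^sup>2 / 2"
    using True unfolding kernel_def by (simp add: power2_eq_square abs_le_iff algebra_simps)
  also have "\<dots> \<le> (2 + \<theta>\<^sup>2) * x\<^sup>2" by (simp add: power_mult_distrib algebra_simps)
  also have "x\<^sup>2 = min 1 (x\<^sup>2)" using True abs_square_le_1[of x] by linarith
  finally show ?thesis .
next
  case False
  then have "kernel \<theta> x = iexp (\<theta> * x) - 1" unfolding kernel_def by (auto simp: indicator_def)
  then have "cmod (kernel \<theta> x) \<le> cmod (iexp (\<theta> * x)) + cmod 1"
    by (simp only: norm_triangle_ineq4)
  then have "cmod (kernel \<theta> x) \<le> 2" by simp
  moreover have "1 \<le> x\<^sup>2" using False by (simp add: abs_square_le_1[symmetric] less_imp_le not_le abs_le_square_iff[of 1, simplified])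
  ultimately show ?thesis by (simp add: min_def add_increasing2)
qed

lemma integrable_kernel: "integrable \<nu> (kernel \<theta>)"
  by (rule Bochner_Integration.integrable_bound[where f="\<lambda>x. (2 + \<theta>\<^sup>2) * min 1 (x\<^sup>2)"])
     (use integrable_min cmod_kernel_le in \<open>auto intro: AE_I2 order_trans\<close>)

lemma psi_eq: "\<psi> \<theta> = \<i> * complex_of_real (b * \<theta>) - complex_of_real (v * \<theta>\<^sup>2 / 2) + integral\<^sup>L \<nu> (kernel \<theta>)"
  unfolding levy_exponent_def kernel_def ..

lemma psi_zero: "\<psi> 0 = 0"
proof -
  have "kernel 0 = (\<lambda>_. 0)" by (simp add: kernel_def fun_eq_iff)
  then show ?thesis unfolding psi_eq by simp
qed

lemma continuous_psi: "continuous_on UNIV \<psi>"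
proof -
  have "isCont (\<lambda>\<theta>. integral\<^sup>L \<nu> (kernel \<theta>)) t" for t
    unfolding continuous_at_sequentially comp_def
  proof safe
    fix u :: "nat \<Rightarrow> real" assume u: "u \<longlonglongrightarrow> t"
    then have "Bseq u" by (intro convergent_imp_Bseq convergentI)
    then obtain K where K: "0 < K" "\<And>n. \<bar>u n\<bar> \<le> K" unfolding Bseq_def by auto
    show "(\<lambda>n. integral\<^sup>L \<nu> (kernel (u n))) \<longlonglongrightarrow> integral\<^sup>L \<nu> (kernel t)"
    proof (rule integral_dominated_convergence[where w="\<lambda>x. (2 + K\<^sup>2) * min 1 (x\<^sup>2)"])
      show "AE x in \<nu>. (\<lambda>n. kernel (u n) x) \<longlonglongrightarrow> kernel t x"
        unfolding kernel_def by (intro AE_I2 tendsto_intros u)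
      show "AE x in \<nu>. cmod (kernel (u n) x) \<le> (2 + K\<^sup>2) * min 1 (x\<^sup>2)" for n
      proof (rule AE_I2)
        fix x
        have "(u n)\<^sup>2 \<le> K\<^sup>2" using K by (metis abs_le_square_iff abs_of_pos)
        then show "cmod (kernel (u n) x) \<le> (2 + K\<^sup>2) * min 1 (x\<^sup>2)"
          by (intro order_trans[OF cmod_kernel_le] mult_right_mono) auto
      qed
    qed (use integrable_min in auto)
  qed
  then have "continuous_on UNIV (\<lambda>\<theta>. integral\<^sup>L \<nu> (kernel \<theta>))"
    by (simp add: continuous_at_imp_continuous_on)
  then show ?thesis unfolding psi_eq[abs_def] by (intro continuous_intros) auto
qed

lemma psi_quadratic_growth: "\<exists>C\<ge>0. \<forall>\<theta>. cmod (\<psi> \<theta>) \<le> C * (1 + \<theta>\<^sup>2)"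
proof -
  define I where "I = (\<integral>x. min 1 (x\<^sup>2) \<partial>\<nu>)"
  have I0: "0 \<le> I" unfolding I_def by (rule Bochner_Integration.integral_nonneg) auto
  show ?thesis
  proof (intro exI conjI allI)
    show "0 \<le> \<bar>b\<bar> + v + 2 * I" using I0 v_nonneg by simp
    fix \<theta>
    have "cmod (integral\<^sup>L \<nu> (kernel \<theta>)) \<le> (\<integral>x. cmod (kernel \<theta> x) \<partial>\<nu>)"
      by (rule integral_norm_bound)
    also have "\<dots> \<le> (\<integral>x. (2 + \<theta>\<^sup>2) * min 1 (x\<^sup>2) \<partial>\<nu>)"
      using integrable_kernel integrable_min cmod_kernel_le by (intro integral_mono) auto
    also have "\<dots> = (2 + \<theta>\<^sup>2) * I" using integrable_min by (simp add: I_def)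
    finally have 1: "cmod (integral\<^sup>L \<nu> (kernel \<theta>)) \<le> (2 + \<theta>\<^sup>2) * I" .
    have 2: "\<bar>\<theta>\<bar> \<le> 1 + \<theta>\<^sup>2"
    proof -
      have "2 * \<bar>\<theta>\<bar> \<le> 1 + \<theta>\<^sup>2" using zero_le_power2[of "\<bar>\<theta>\<bar> - 1"] by (simp add: power2_diff)
      then show ?thesis by simp
    qed
    have "cmod (\<psi> \<theta>) \<le> \<bar>b\<bar> * \<bar>\<theta>\<bar> + v * \<theta>\<^sup>2 / 2 + (2 + \<theta>\<^sup>2) * I"
      unfolding psi_eq using v_nonneg
      by (intro order_trans[OF norm_triangle_ineq] add_mono 1 order_trans[OF norm_triangle_ineq4])
         (simp_all add: norm_mult abs_mult del: of_real_mult of_real_divide of_real_power)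
    also have "\<dots> \<le> \<bar>b\<bar> * (1 + \<theta>\<^sup>2) + v * (1 + \<theta>\<^sup>2) + (2 * (1 + \<theta>\<^sup>2)) * I"
      using v_nonneg I0 2
      by (intro add_mono mult_left_mono mult_right_mono) (auto simp: algebra_simps add_increasing)
    also have "\<dots> = (\<bar>b\<bar> + v + 2 * I) * (1 + \<theta>\<^sup>2)" by (simp add: algebra_simps)
    finally show "cmod (\<psi> \<theta>) \<le> (\<bar>b\<bar> + v + 2 * I) * (1 + \<theta>\<^sup>2)" .
  qed
qed

lemma Re_psi: "- Re (\<psi> \<theta>) = v * \<theta>\<^sup>2 / 2 + (\<integral>x. 1 - cos (\<theta> * x) \<partial>\<nu>)"
  and integrable_one_minus_cos: "integrable \<nu> (\<lambda>x. 1 - cos (\<theta> * x))"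
proof -
  have e: "Re (kernel \<theta> x) = - (1 - cos (\<theta> * x))" for x by (simp add: kernel_def Re_exp)
  have i: "integrable \<nu> (\<lambda>x. Re (kernel \<theta> x))" using integrable_kernel by (rule integrable_Re)
  show "integrable \<nu> (\<lambda>x. 1 - cos (\<theta> * x))" using Bochner_Integration.integrable_minus[OF i] unfolding e by simp
  have "Re (integral\<^sup>L \<nu> (kernel \<theta>)) = (\<integral>x. Re (kernel \<theta> x) \<partial>\<nu>)"
    using integrable_kernel by simp
  also have "\<dots> = - (\<integral>x. 1 - cos (\<theta> * x) \<partial>\<nu>)" unfolding e by (rule integral_minus)
  finally show "- Re (\<psi> \<theta>) = v * \<theta>\<^sup>2 / 2 + (\<integral>x. 1 - cos (\<theta> * x) \<partial>\<nu>)"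
    unfolding psi_eq by simp
qed

text \<open>
  Jumps of size at most \<open>1\<close> and the Gaussian part contribute a multiple of \<open>\<theta>\<^sup>2\<close>, which on a
  bounded set is dominated by \<open>\<bar>\<theta>\<bar> powr \<beta>\<close> since \<open>\<beta> \<le> 2\<close>. For larger jumps
  \<open>1 - cos (\<theta> * x) \<le> 2 * \<bar>\<theta> * x\<bar> powr \<beta>\<close>, again because \<open>\<beta> \<le> 2\<close>, and the tail moment of
  order \<open>\<beta>\<close> appears.
\<close>

lemma Re_psi_powr_bound:
  assumes \<beta>: "0 < \<beta>" "\<beta> \<le> 2"
    and mom: "(\<integral>\<^sup>+x\<in>{x. 1 < \<bar>x\<bar>}. ennreal (\<bar>x\<bar> powr \<beta>) \<partial>\<nu>) < \<infinity>"
  shows "\<exists>D\<ge>0. \<forall>\<theta>. \<bar>\<theta>\<bar> \<le> L \<longrightarrow> - Re (\<psi> \<theta>) \<le> D * \<bar>\<theta>\<bar> powr \<beta>"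
proof -
  define J where "J = (\<integral>x. \<bar>x\<bar> powr \<beta> * indicator {x. 1 < \<bar>x\<bar>} x \<partial>\<nu>)"
  have iJ: "integrable \<nu> (\<lambda>x. \<bar>x\<bar> powr \<beta> * indicator {x. 1 < \<bar>x\<bar>} x)"
    by (rule integrableI_nonneg) (use mom in \<open>auto simp: ennreal_mult'' ennreal_indicator\<close>)
  have J0: "0 \<le> J" unfolding J_def by (rule Bochner_Integration.integral_nonneg) auto
  define I where "I = (\<integral>x. min 1 (x\<^sup>2) \<partial>\<nu>)"
  have I0: "0 \<le> I" unfolding I_def by (rule Bochner_Integration.integral_nonneg) auto
  define E where "E = \<bar>L\<bar> powr (2 - \<beta>)"
  have E0: "0 \<le> E" unfolding E_def by simp
  have sq: "\<theta>\<^sup>2 \<le> E * \<bar>\<theta>\<bar> powr \<beta>" if "\<bar>\<theta>\<bar> \<le> L" for \<theta>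
  proof (cases "\<theta> = 0")
    case False
    have "\<theta>\<^sup>2 = \<bar>\<theta>\<bar> powr 2" using False by simp
    also have "\<dots> = \<bar>\<theta>\<bar> powr (2 - \<beta>) * \<bar>\<theta>\<bar> powr \<beta>" by (simp flip: powr_add)
    also have "\<dots> \<le> E * \<bar>\<theta>\<bar> powr \<beta>"
      unfolding E_def using that \<beta> by (intro mult_right_mono powr_mono2) auto
    finally show ?thesis .
  qed simp
  show ?thesis
  proof (intro exI conjI allI impI)
    show "0 \<le> (v / 2 + 2 * I) * E + 2 * J" using v_nonneg I0 J0 E0 by simp
    fix \<theta> assume t: "\<bar>\<theta>\<bar> \<le> L"
    have "(\<integral>x. 1 - cos (\<theta> * x) \<partial>\<nu>) \<le> (\<integral>x. 2 * \<theta>\<^sup>2 * min 1 (x\<^sup>2) +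
        2 * \<bar>\<theta>\<bar> powr \<beta> * (\<bar>x\<bar> powr \<beta> * indicator {x. 1 < \<bar>x\<bar>} x) \<partial>\<nu>)"
    proof (rule integral_mono)
      fix x
      show "1 - cos (\<theta> * x) \<le> 2 * \<theta>\<^sup>2 * min 1 (x\<^sup>2) +
          2 * \<bar>\<theta>\<bar> powr \<beta> * (\<bar>x\<bar> powr \<beta> * indicator {x. 1 < \<bar>x\<bar>} x)"
      proof (cases "1 < \<bar>x\<bar>")
        case True
        then show ?thesis
          using one_minus_cos_le_powr[of \<beta> "\<theta> * x"] \<beta>
          by (simp add: abs_mult powr_mult add_increasing)
      next
        case False
        then have "x\<^sup>2 \<le> 1" by (simp add: abs_square_le_1)
        then show ?thesis using one_minus_cos_le_powr[of 2 "\<theta> * x"] False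
          by (cases "\<theta> * x = 0") (auto simp: power_mult_distrib)
      qed
    qed (use integrable_one_minus_cos integrable_min iJ in auto)
    also have "\<dots> = 2 * \<theta>\<^sup>2 * I + 2 * \<bar>\<theta>\<bar> powr \<beta> * J"
      using integrable_min iJ by (simp add: I_def J_def)
    finally have "- Re (\<psi> \<theta>) \<le> (v / 2 + 2 * I) * \<theta>\<^sup>2 + 2 * J * \<bar>\<theta>\<bar> powr \<beta>"
      unfolding Re_psi by (simp add: algebra_simps)
    also have "\<dots> \<le> (v / 2 + 2 * I) * (E * \<bar>\<theta>\<bar> powr \<beta>) + 2 * J * \<bar>\<theta>\<bar> powr \<beta>"
      using sq[OF t] v_nonneg I0 by (intro add_right_mono mult_left_mono) auto
    finally show "- Re (\<psi> \<theta>) \<le> ((v / 2 + 2 * I) * E + 2 * J) * \<bar>\<theta>\<bar> powr \<beta>"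
      by (simp add: algebra_simps)
  qed
qed

end

section \<open>Scaling of the norming function\<close>

lemma saturation_mono:
  fixes u v :: real
  shows "0 \<le> u \<Longrightarrow> u \<le> v \<Longrightarrow> u / (1 + u) \<le> v / (1 + v)"
    and "0 \<le> u \<Longrightarrow> u < v \<Longrightarrow> u / (1 + u) < v / (1 + v)"
  by (simp_all add: field_simps)

text \<open>
  The small-time limit in terms of one-dimensional laws only: \<open>\<mu> t\<close> is the law of
  \<open>X t\<close>, and \<open>\<kappa>\<close> the law of the limit at time \<open>1\<close>, from which self-similarity
  recovers the limit at time \<open>s\<close> as the law of \<open>s powr H * x\<close> under \<open>\<kappa>\<close>.
\<close>

locale small_time_limit =
  fixes \<mu> :: "real \<Rightarrow> real measure" and \<kappa> :: "real measure"
    and a :: "real \<Rightarrow> real" and H :: real and \<psi> :: "real \<Rightarrow> complex"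
  assumes mu: "0 < t \<Longrightarrow> real_distribution (\<mu> t)"
    and kappa: "real_distribution \<kappa>"
    and kappa_nontrivial: "\<not> (AE x in \<kappa>. x = 0)"
    and a_pos: "0 < t \<Longrightarrow> 0 < a t"
    and weak_limit: "\<And>s (f :: real \<Rightarrow> real). \<lbrakk>0 < s; continuous_on UNIV f; bounded (range f)\<rbrakk> \<Longrightarrow>
          ((\<lambda>t. \<integral>x. f (x / a t) \<partial>\<mu> (t * s)) \<longlongrightarrow> (\<integral>x. f (s powr H * x) \<partial>\<kappa>)) (at_right 0)"
    and char_mu: "0 < t \<Longrightarrow> char (\<mu> t) \<theta> = exp (complex_of_real t * \<psi> \<theta>)"
    and psi_zero: "\<psi> 0 = 0"
    and psi_continuous: "continuous_on UNIV \<psi>"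
    and psi_growth: "\<exists>C\<ge>0. \<forall>\<theta>. cmod (\<psi> \<theta>) \<le> C * (1 + \<theta>\<^sup>2)"
begin

sublocale kappa: real_distribution \<kappa> by (rule kappa)

lemma kappa_strict_decrease:
  assumes c: "0 < c" "c < 1"
  shows "(\<integral>x. \<bar>c * x\<bar> / (1 + \<bar>c * x\<bar>) \<partial>\<kappa>) < (\<integral>x. \<bar>x\<bar> / (1 + \<bar>x\<bar>) \<partial>\<kappa>)"
proof -
  define h where "h x = \<bar>x\<bar> / (1 + \<bar>x\<bar>)" for x :: real
  have hm [measurable]: "h \<in> borel_measurable borel" unfolding h_def by measurable
  have i: "integrable \<kappa> (\<lambda>x. h (r * x))" for r
    by (rule kappa.integrable_const_bound[where B=1]) (auto simp: h_def)
  have i1: "integrable \<kappa> h" using i[of 1] by simp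
  have le: "h (c * x) \<le> h x" and lt: "x \<noteq> 0 \<Longrightarrow> h (c * x) < h x" for x
  proof -
    show lt: "h (c * x) < h x" if "x \<noteq> 0"
    proof -
      have "c * \<bar>x\<bar> < \<bar>x\<bar>" using that c by simp
      then show ?thesis unfolding h_def using c by (intro saturation_mono) (auto simp: abs_mult)
    qed
    show "h (c * x) \<le> h x" by (cases "x = 0") (use lt in auto)
  qed
  have "(\<integral>x. h (c * x) \<partial>\<kappa>) \<noteq> (\<integral>x. h x \<partial>\<kappa>)"
  proof
    assume "(\<integral>x. h (c * x) \<partial>\<kappa>) = (\<integral>x. h x \<partial>\<kappa>)"
    then have "(\<integral>x. h x - h (c * x) \<partial>\<kappa>) = 0" using i i1 by simp
    then have "AE x in \<kappa>. h x - h (c * x) = 0"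
      using i i1 le by (subst (asm) integral_nonneg_eq_0_iff_AE) auto
    then have "AE x in \<kappa>. x = 0"
      by eventually_elim (metis lt eq_iff_diff_eq_0 less_irrefl)
    then show False using kappa_nontrivial by simp
  qed
  moreover have "(\<integral>x. h (c * x) \<partial>\<kappa>) \<le> (\<integral>x. h x \<partial>\<kappa>)"
    by (rule integral_mono) (use i i1 le in auto)
  ultimately show ?thesis unfolding h_def by simp
qed

lemma filterlim_mult_at_right_0:
  fixes s :: real assumes "0 < s" shows "filterlim (\<lambda>t. t * s) (at_right 0) (at_right 0)"
  unfolding filterlim_at
proof
  have "((\<lambda>t. t * s) \<longlongrightarrow> 0 * s) (at_right 0)" by (intro tendsto_intros)
  then show "((\<lambda>t. t * s) \<longlongrightarrow> 0) (at_right 0)" by simp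
  show "\<forall>\<^sub>F t in at_right 0. t * s \<in> {0<..} \<and> t * s \<noteq> 0"
    using eventually_at_right_less[of 0] by eventually_elim (use assms in auto)
qed

text \<open>
  A one-sided convergence-of-types argument. Normalized by \<open>a (t * s)\<close>, the variable \<open>X (t * s)\<close>
  converges to the limit at time \<open>1\<close>; normalized by \<open>\<rho> * a t\<close>, it converges to that
  limit multiplied by \<open>s powr H / \<rho> < 1\<close>, which is strictly smaller in the mean of the
  function \<open>\<bar>x\<bar> / (1 + \<bar>x\<bar>)\<close>, which increases with \<open>\<bar>x\<bar>\<close>. If \<open>a (t * s)\<close> exceeded \<open>\<rho> * a t\<close>
  for arbitrarily small \<open>t\<close>, monotonicity would give the opposite inequality between the means.
\<close>

lemma norming_ratio_le:
  assumes s: "0 < s" and \<rho>: "s powr H < \<rho>"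
  shows "\<forall>\<^sub>F t in at_right 0. a (t * s) \<le> \<rho> * a t"
proof -
  define h where "h x = \<bar>x\<bar> / (1 + \<bar>x\<bar>)" for x :: real
  have hm [measurable]: "h \<in> borel_measurable borel" unfolding h_def by measurable
  have hc: "continuous_on UNIV h" unfolding h_def
    by (intro continuous_intros) (auto simp: add_nonneg_eq_0_iff)
  have hb: "bounded (range (\<lambda>x. h (r * x)))" for r
    by (rule boundedI[where B=1]) (auto simp: h_def)
  have \<rho>0: "0 < \<rho>" using \<rho> s by (smt (verit) powr_gt_zero)
  define c where "c = s powr H / \<rho>"
  have c: "0 < c" "c < 1" using \<rho> \<rho>0 s unfolding c_def by auto
  have L1: "((\<lambda>t. \<integral>x. h (1 / \<rho> * (x / a t)) \<partial>\<mu> (t * s)) \<longlongrightarrow> (\<integral>x. h (1 / \<rho> * (s powr H * x)) \<partial>\<kappa>)) (at_right 0)"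
    by (rule weak_limit[OF s]) (intro continuous_on_compose2[OF hc] continuous_intros subset_UNIV, rule hb)
  have "((\<lambda>t. \<integral>x. h (x / a t) \<partial>\<mu> (t * 1)) \<longlongrightarrow> (\<integral>x. h (1 powr H * x) \<partial>\<kappa>)) (at_right 0)"
    by (rule weak_limit) (use hc hb[of 1] in auto)
  then have "((\<lambda>t. \<integral>x. h (x / a t) \<partial>\<mu> t) \<longlongrightarrow> (\<integral>x. h x \<partial>\<kappa>)) (at_right 0)" by simp
  from filterlim_compose[OF this filterlim_mult_at_right_0[OF s]]
  have L2: "((\<lambda>t. \<integral>x. h (x / a (t * s)) \<partial>\<mu> (t * s)) \<longlongrightarrow> (\<integral>x. h x \<partial>\<kappa>)) (at_right 0)" .
  have "(\<integral>x. h (1 / \<rho> * (s powr H * x)) \<partial>\<kappa>) < (\<integral>x. h x \<partial>\<kappa>)"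
    using kappa_strict_decrease[OF c] by (simp add: h_def c_def)
  then obtain m where m: "(\<integral>x. h (1 / \<rho> * (s powr H * x)) \<partial>\<kappa>) < m" "m < (\<integral>x. h x \<partial>\<kappa>)"
    using dense by blast
  show ?thesis
    using order_tendstoD(2)[OF L1 m(1)] order_tendstoD(1)[OF L2 m(2)] eventually_at_right_less[of 0]
  proof eventually_elim
    case (elim t)
    show ?case
    proof (rule ccontr)
      assume "\<not> a (t * s) \<le> \<rho> * a t"
      then have r: "\<rho> * a t < a (t * s)" by simp
      have at: "0 < a t" "0 < a (t * s)" using a_pos elim s by auto
      interpret real_distribution "\<mu> (t * s)" by (rule mu) (use elim s in auto)
      have i: "integrable (\<mu> (t * s)) (\<lambda>x. h (r * x))" for r
        by (rule integrable_const_bound[where B=1]) (auto simp: h_def)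
      have mono: "h x \<le> h y" if "\<bar>x\<bar> \<le> \<bar>y\<bar>" for x y
        using that unfolding h_def by (intro saturation_mono) auto
      have "(\<integral>x. h (x / a (t * s)) \<partial>\<mu> (t * s)) \<le> (\<integral>x. h (1 / \<rho> * (x / a t)) \<partial>\<mu> (t * s))"
      proof (rule integral_mono)
        fix x
        show "h (x / a (t * s)) \<le> h (1 / \<rho> * (x / a t))"
          using r at \<rho>0 by (intro mono) (auto simp: abs_mult abs_divide intro!: divide_left_mono)
      qed (use i[of "1 / a (t * s)"] i[of "1 / \<rho> * (1 / a t)"] in auto)
      then show False using elim by linarith
    qed
  qed
qed

lemma char_limit: "((\<lambda>t. exp (complex_of_real t * \<psi> (\<theta> / a t))) \<longlongrightarrow> char \<kappa> \<theta>) (at_right 0)"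
proof -
  have b: "bounded (range (\<lambda>x. cos (\<theta> * x)))" "bounded (range (\<lambda>x. sin (\<theta> * x)))"
    by (rule boundedI[where B=1]; force)+
  have c: "((\<lambda>t. \<integral>x. cos (\<theta> * (x / a t)) \<partial>\<mu> t) \<longlongrightarrow> (\<integral>x. cos (\<theta> * x) \<partial>\<kappa>)) (at_right 0)"
    using weak_limit[of 1 "\<lambda>x. cos (\<theta> * x)"] b by (simp add: continuous_intros)
  have s: "((\<lambda>t. \<integral>x. sin (\<theta> * (x / a t)) \<partial>\<mu> t) \<longlongrightarrow> (\<integral>x. sin (\<theta> * x) \<partial>\<kappa>)) (at_right 0)"
    using weak_limit[of 1 "\<lambda>x. sin (\<theta> * x)"] b by (simp add: continuous_intros)
  have "((\<lambda>t. Complex (\<integral>x. cos (\<theta> * (x / a t)) \<partial>\<mu> t) (\<integral>x. sin (\<theta> * (x / a t)) \<partial>\<mu> t)) \<longlongrightarrow> char \<kappa> \<theta>) (at_right 0)"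
    unfolding kappa.char_eq_cos_sin by (rule tendsto_Complex[OF c s])
  moreover have "\<forall>\<^sub>F t in at_right 0. Complex (\<integral>x. cos (\<theta> * (x / a t)) \<partial>\<mu> t) (\<integral>x. sin (\<theta> * (x / a t)) \<partial>\<mu> t)
       = exp (complex_of_real t * \<psi> (\<theta> / a t))"
    using eventually_at_right_less[of 0]
  proof eventually_elim
    case (elim t)
    then interpret real_distribution "\<mu> t" by (rule mu)
    show ?case using char_mu[OF elim, of "\<theta> / a t"] char_eq_cos_sin[of "\<theta> / a t"] by simp
  qed
  ultimately show ?thesis by (rule Lim_transform_eventually)
qed

text \<open>
  The characteristic function of the limit would be constantly \<open>1\<close>, making the limit the point
  mass at \<open>0\<close>.
\<close>

lemma exponent_not_vanishing:
  assumes u: "u \<longlonglongrightarrow> 0" "\<And>n. 0 < u n"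
    and lim: "\<And>\<theta>. (\<lambda>n. complex_of_real (u n) * \<psi> (\<theta> / a (u n))) \<longlonglongrightarrow> 0"
  shows False
proof -
  have f: "filterlim u (at_right 0) sequentially"
    by (rule tendsto_imp_filterlim_at_right) (use u in auto)
  have "char \<kappa> \<theta> = char (return borel 0) \<theta>" for \<theta>
  proof -
    have "(\<lambda>n. exp (complex_of_real (u n) * \<psi> (\<theta> / a (u n)))) \<longlonglongrightarrow> char \<kappa> \<theta>"
      by (rule filterlim_compose[OF char_limit f])
    moreover have "(\<lambda>n. exp (complex_of_real (u n) * \<psi> (\<theta> / a (u n)))) \<longlonglongrightarrow> exp 0"
      by (intro tendsto_exp lim)
    ultimately have "char \<kappa> \<theta> = 1" using LIMSEQ_unique by force
    also have "1 = char (return borel 0) \<theta>" unfolding char_def by (subst integral_return) auto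
    finally show ?thesis .
  qed
  moreover have "real_distribution (return borel (0::real))"
    by (intro real_distribution.intro prob_space_return real_distribution_axioms.intro) auto
  ultimately have "\<kappa> = return borel 0" by (intro Levy_uniqueness kappa) auto
  moreover have "AE x in return borel (0::real). x = 0" by (simp add: AE_return)
  ultimately have "AE x in \<kappa>. x = 0" by (simp only:)
  then show False by (rule notE[OF kappa_nontrivial])
qed

text \<open>
  If \<open>H < 1/2\<close>, then halving a small time divides \<open>a\<close> by at most some \<open>\<rho> < sqrt 2\<close>, so
  \<open>t / (a t)\<^sup>2\<close> tends to \<open>0\<close> along a dyadic sequence. As \<open>\<psi>\<close> grows at most quadratically,
  the exponents \<open>t * \<psi> (\<theta> / a t)\<close> then vanish in the limit, against non-triviality.
\<close>

lemma index_ge_half: "1/2 \<le> H"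
proof (rule ccontr)
  assume "\<not> 1/2 \<le> H"
  then have "2 powr H < 2 powr (1/2)" by (intro powr_less_mono) auto
  then obtain \<rho> where \<rho>: "2 powr H < \<rho>" "\<rho> < 2 powr (1/2)" using dense by blast
  have \<rho>0: "0 < \<rho>" using \<rho>(1) by (smt (verit) powr_gt_zero)
  have \<rho>2: "\<rho>\<^sup>2 < 2"
  proof -
    have "\<rho>\<^sup>2 < (2 powr (1/2))\<^sup>2" using \<rho> \<rho>0 by (intro power_strict_mono) auto
    then show ?thesis by (simp add: powr_half_sqrt)
  qed
  obtain t0 where t0: "0 < t0" "\<And>t. 0 < t \<Longrightarrow> t < t0 \<Longrightarrow> a (t * 2) \<le> \<rho> * a t"
    using norming_ratio_le[of 2 \<rho>] \<rho> unfolding eventually_at_right_field by auto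
  define u where "u n = t0 / 2 ^ Suc n" for n
  have u0: "0 < u n" and ut: "u n < t0" for n
  proof -
    show "0 < u n" unfolding u_def using t0 by simp
    have "(1::real) < 2 ^ Suc n" by (rule one_less_power) auto
    then show "u n < t0" unfolding u_def using t0 by (simp add: divide_less_eq)
  qed
  have ulim: "u \<longlonglongrightarrow> 0"
    using LIMSEQ_Suc[OF LIMSEQ_divide_realpow_zero[of 2 t0]] unfolding u_def by simp
  define w where "w n = u n / (a (u n))\<^sup>2" for n
  have step: "w (Suc n) \<le> \<rho>\<^sup>2 / 2 * w n" for n
  proof -
    have e: "u (Suc n) * 2 = u n" unfolding u_def by simp
    have ap: "0 < a (u n)" "0 < a (u (Suc n))" using a_pos u0 by auto
    have "a (u n) \<le> \<rho> * a (u (Suc n))" using t0(2)[OF u0 ut, of "Suc n"] by (simp only: e)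
    then have "(a (u n))\<^sup>2 \<le> \<rho>\<^sup>2 * (a (u (Suc n)))\<^sup>2"
      using ap by (metis power_mono less_imp_le power_mult_distrib)
    then have "u n * (a (u n))\<^sup>2 \<le> u n * (\<rho>\<^sup>2 * (a (u (Suc n)))\<^sup>2)"
      using u0[of n] by (intro mult_left_mono) auto
    then show ?thesis unfolding w_def using ap e[symmetric] by (simp add: field_simps)
  qed
  have wle: "w n \<le> (\<rho>\<^sup>2 / 2) ^ n * w 0" for n
  proof (induction n)
    case (Suc n)
    have "w (Suc n) \<le> \<rho>\<^sup>2 / 2 * ((\<rho>\<^sup>2 / 2) ^ n * w 0)"
      by (rule order_trans[OF step mult_left_mono[OF Suc]]) auto
    then show ?case by (simp add: mult.assoc)
  qed simp
  have w0: "0 \<le> w n" for n unfolding w_def using u0[of n] by simp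
  have "(\<lambda>n. (\<rho>\<^sup>2 / 2) ^ n * w 0) \<longlonglongrightarrow> 0 * w 0"
    using \<rho>2 by (intro tendsto_intros LIMSEQ_power_zero) auto
  then have wlim: "w \<longlonglongrightarrow> 0"
    by (intro tendsto_sandwich[of "\<lambda>_. 0" w sequentially "\<lambda>n. (\<rho>\<^sup>2 / 2) ^ n * w 0"])
       (use wle w0 in auto)
  obtain C where C: "0 \<le> C" "\<And>\<theta>. cmod (\<psi> \<theta>) \<le> C * (1 + \<theta>\<^sup>2)" using psi_growth by blast
  show False
  proof (rule exponent_not_vanishing[OF ulim u0])
    fix \<theta>
    have "(\<lambda>n. C * (u n + \<theta>\<^sup>2 * w n)) \<longlonglongrightarrow> C * (0 + \<theta>\<^sup>2 * 0)"
      by (intro tendsto_intros ulim wlim)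
    then have z: "(\<lambda>n. C * (u n + \<theta>\<^sup>2 * w n)) \<longlonglongrightarrow> 0" by simp
    show "(\<lambda>n. complex_of_real (u n) * \<psi> (\<theta> / a (u n))) \<longlonglongrightarrow> 0"
    proof (rule Lim_null_comparison[OF _ z], rule always_eventually, rule allI)
      fix n
      have "cmod (complex_of_real (u n) * \<psi> (\<theta> / a (u n))) \<le> u n * (C * (1 + (\<theta> / a (u n))\<^sup>2))"
        using u0[of n] by (simp add: norm_mult C mult_left_mono)
      also have "\<dots> = C * (u n + \<theta>\<^sup>2 * w n)"
        by (simp add: w_def power_divide algebra_simps)
      finally show "cmod (complex_of_real (u n) * \<psi> (\<theta> / a (u n))) \<le> C * (u n + \<theta>\<^sup>2 * w n)" .
    qed
  qed
qed

end

section \<open>Uniform control of the exponent\<close>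

text \<open>
  The disc of radius \<open>1/2\<close> around \<open>1\<close> lies in the right half-plane, so the imaginary part can
  never cross \<open>pi / 2\<close> or \<open>- pi / 2\<close> on its way from \<open>0\<close>.
\<close>

lemma Im_bound_of_exp_near_one:
  fixes F :: "real \<Rightarrow> complex"
  assumes c: "continuous_on {0..1} F" and F0: "F 0 = 0"
    and near: "\<And>r. 0 \<le> r \<Longrightarrow> r \<le> 1 \<Longrightarrow> cmod (exp (F r) - 1) \<le> 1/2"
  shows "\<bar>Im (F 1)\<bar> < pi / 2"
proof (rule ccontr)
  assume "\<not> ?thesis"
  then have 1: "pi / 2 \<le> \<bar>Im (F 1)\<bar>" by simp
  have "continuous_on {0..1} (\<lambda>r. \<bar>Im (F r)\<bar>)" by (intro continuous_intros c)
  then obtain r where r: "0 \<le> r" "r \<le> 1" "\<bar>Im (F r)\<bar> = pi / 2"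
    using IVT'[of "\<lambda>r. \<bar>Im (F r)\<bar>" 0 "pi/2" 1] 1 F0 by auto
  then have "Im (F r) = pi / 2 \<or> Im (F r) = - (pi / 2)" by linarith
  then have "cos (Im (F r)) = 0" by (metis cos_pi_half cos_minus)
  then have "Re (exp (F r)) = 0" by (simp add: Re_exp)
  then have "1 \<le> cmod (exp (F r) - 1)" using abs_Re_le_cmod[of "exp (F r) - 1"] by simp
  with near[of r] r show False by simp
qed

context small_time_limit
begin

text \<open>
  Both conclusions come from the single bounded continuous function \<open>min 2 (\<theta>0 * \<bar>x\<bar>)\<close>:
  it dominates \<open>\<bar>iexp (\<theta> * x) - 1\<bar>\<close> for \<open>\<bar>\<theta>\<bar> \<le> \<theta>0\<close> as well as the indicator of
  \<open>\<bar>x\<bar> > 1 / \<theta>0\<close>, and its mean under \<open>\<kappa>\<close> is below \<open>1/2\<close> once \<open>\<theta>0\<close> is small.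
\<close>

lemma uniform_tightness:
  obtains \<theta>0 t0 where "0 < \<theta>0" "0 < t0"
    "\<And>t \<theta>. \<lbrakk>0 < t; t < t0; \<bar>\<theta>\<bar> \<le> \<theta>0\<rbrakk> \<Longrightarrow> cmod (exp (complex_of_real t * \<psi> (\<theta> / a t)) - 1) \<le> 1/2"
    "\<And>t. \<lbrakk>0 < t; t < t0\<rbrakk> \<Longrightarrow> 1/2 \<le> measure (\<mu> t) {x. \<bar>x / a t\<bar> \<le> 1 / \<theta>0}"
proof -
  have "(\<lambda>n. \<integral>x. min 2 (1 / real (Suc n) * \<bar>x\<bar>) \<partial>\<kappa>) \<longlonglongrightarrow> (\<integral>x. 0 \<partial>\<kappa>)"
  proof (rule integral_dominated_convergence[where w="\<lambda>_. 2"])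
    show "AE x in \<kappa>. (\<lambda>n. min 2 (1 / real (Suc n) * \<bar>x\<bar>)) \<longlonglongrightarrow> 0"
    proof (rule AE_I2)
      fix x
      have "(\<lambda>n. min 2 (1 / real (Suc n) * \<bar>x\<bar>)) \<longlonglongrightarrow> min 2 (0 * \<bar>x\<bar>)"
        by (intro tendsto_min tendsto_const tendsto_mult LIMSEQ_Suc[OF lim_1_over_n])
      then show "(\<lambda>n. min 2 (1 / real (Suc n) * \<bar>x\<bar>)) \<longlonglongrightarrow> 0" by simp
    qed
  qed auto
  then have "(\<lambda>n. \<integral>x. min 2 (1 / real (Suc n) * \<bar>x\<bar>) \<partial>\<kappa>) \<longlonglongrightarrow> 0" by simp
  from order_tendstoD(2)[OF this, of "1/2"]
  obtain n where n: "(\<integral>x. min 2 (1 / real (Suc n) * \<bar>x\<bar>) \<partial>\<kappa>) < 1/2"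
    unfolding eventually_sequentially by auto
  define \<theta>0 where "\<theta>0 = 1 / real (Suc n)"
  have \<theta>0: "0 < \<theta>0" unfolding \<theta>0_def by simp
  have "((\<lambda>t. \<integral>x. min 2 (\<theta>0 * \<bar>x / a t\<bar>) \<partial>\<mu> (t * 1)) \<longlongrightarrow> (\<integral>x. min 2 (\<theta>0 * \<bar>1 powr H * x\<bar>) \<partial>\<kappa>)) (at_right 0)"
    by (rule weak_limit) (auto intro!: continuous_intros boundedI[where B=2] simp: \<theta>0_def)
  then have L: "((\<lambda>t. \<integral>x. min 2 (\<theta>0 * \<bar>x / a t\<bar>) \<partial>\<mu> t) \<longlongrightarrow> (\<integral>x. min 2 (\<theta>0 * \<bar>x\<bar>) \<partial>\<kappa>)) (at_right 0)"
    by simp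
  obtain t0 where t0: "0 < t0"
    and small: "\<And>t. 0 < t \<Longrightarrow> t < t0 \<Longrightarrow> (\<integral>x. min 2 (\<theta>0 * \<bar>x / a t\<bar>) \<partial>\<mu> t) < 1/2"
    using order_tendstoD(2)[OF L, of "1/2"] n unfolding \<theta>0_def[symmetric] eventually_at_right_field
    by auto
  show ?thesis
  proof (rule that[OF \<theta>0 t0])
    fix t :: real assume t: "0 < t" "t < t0"
    interpret real_distribution "\<mu> t" by (rule mu) (rule t)
    have p1: "measure (\<mu> t) UNIV = 1" using prob_space by (simp only: space_eq_univ)
    have at: "0 < a t" using a_pos t by simp
    have im: "integrable (\<mu> t) (\<lambda>x. min 2 (\<theta>0 * \<bar>x / a t\<bar>))"
      by (rule integrable_const_bound[where B=2]) (use \<theta>0 in auto)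
    {
      fix \<theta> :: real assume th: "\<bar>\<theta>\<bar> \<le> \<theta>0"
      have ii: "integrable (\<mu> t) (\<lambda>x. iexp (\<theta> / a t * x))" by (rule integrable_iexp) auto
      have "cmod (char (\<mu> t) (\<theta> / a t) - 1) = cmod (\<integral>x. iexp (\<theta> / a t * x) - 1 \<partial>\<mu> t)"
        unfolding char_def using ii by (simp add: p1)
      also have "\<dots> \<le> (\<integral>x. cmod (iexp (\<theta> / a t * x) - 1) \<partial>\<mu> t)"
        by (rule integral_norm_bound)
      also have "\<dots> \<le> (\<integral>x. min 2 (\<theta>0 * \<bar>x / a t\<bar>) \<partial>\<mu> t)"
      proof (rule integral_mono)
        show "integrable (\<mu> t) (\<lambda>x. cmod (iexp (\<theta> / a t * x) - 1))" using ii by auto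
        fix x
        have "cmod (iexp (\<theta> / a t * x) - 1) \<le> cmod (iexp (\<theta> / a t * x)) + cmod 1"
          by (rule norm_triangle_ineq4)
        moreover have "cmod (iexp (\<theta> / a t * x) - 1) \<le> \<bar>\<theta> / a t * x\<bar>"
          using iexp_approx1[of "\<theta> / a t * x" 0] by simp
        moreover have "\<bar>\<theta> / a t * x\<bar> \<le> \<theta>0 * \<bar>x / a t\<bar>"
          using th at by (simp add: abs_mult abs_divide divide_right_mono mult_right_mono)
        ultimately show "cmod (iexp (\<theta> / a t * x) - 1) \<le> min 2 (\<theta>0 * \<bar>x / a t\<bar>)" by simp
      qed (rule im)
      also have "\<dots> \<le> 1/2" using small[OF t] by simp
      finally show "cmod (exp (complex_of_real t * \<psi> (\<theta> / a t)) - 1) \<le> 1/2"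
        unfolding char_mu[OF t(1)] .
    }
    have "prob {x. 1 / \<theta>0 < \<bar>x / a t\<bar>} = (\<integral>x. indicator {x. 1 / \<theta>0 < \<bar>x / a t\<bar>} x \<partial>\<mu> t)"
      by simp
    also have "\<dots> \<le> (\<integral>x. min 2 (\<theta>0 * \<bar>x / a t\<bar>) \<partial>\<mu> t)"
    proof (rule integral_mono)
      show "integrable (\<mu> t) (\<lambda>x. indicat_real {x. 1 / \<theta>0 < \<bar>x / a t\<bar>} x)"
        by (rule integrable_const_bound[where B=1]) (auto simp: indicator_def)
      fix x show "indicator {x. 1 / \<theta>0 < \<bar>x / a t\<bar>} x \<le> min 2 (\<theta>0 * \<bar>x / a t\<bar>)"
        using \<theta>0 at by (auto simp: indicator_def field_simps)
    qed (rule im)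
    finally have "prob {x. 1 / \<theta>0 < \<bar>x / a t\<bar>} \<le> 1/2" using small[OF t] by simp
    moreover have "prob (space (\<mu> t) - {x. 1 / \<theta>0 < \<bar>x / a t\<bar>}) = 1 - prob {x. 1 / \<theta>0 < \<bar>x / a t\<bar>}"
      by (rule prob_compl) simp
    moreover have "space (\<mu> t) - {x. 1 / \<theta>0 < \<bar>x / a t\<bar>} = {x. \<bar>x / a t\<bar> \<le> 1 / \<theta>0}" by auto
    ultimately show "1/2 \<le> prob {x. \<bar>x / a t\<bar> \<le> 1 / \<theta>0}" by simp
  qed
qed

lemma Re_psi_nonpos: "Re (\<psi> \<theta>) \<le> 0"
proof -
  interpret real_distribution "\<mu> 1" by (rule mu) simp
  show ?thesis using cmod_char_le_1[of \<theta>] char_mu[of 1 \<theta>] by simp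
qed

text \<open>
  The imaginary part has to be followed continuously from frequency \<open>0\<close>, as the exponential
  determines it only modulo \<open>2 * pi\<close>.
\<close>

lemma exponent_bounded_near_zero:
  assumes t: "0 < t"
    and near: "\<And>\<theta>. \<bar>\<theta>\<bar> \<le> \<theta>0 \<Longrightarrow> cmod (exp (complex_of_real t * \<psi> (\<theta> / a t)) - 1) \<le> 1/2"
    and th: "\<bar>\<theta>\<bar> \<le> \<theta>0"
  shows "t * (- Re (\<psi> (\<theta> / a t))) \<le> 1"
    and "t * cmod (\<psi> (\<theta> / a t)) \<le> 3"
proof -
  let ?z = "complex_of_real t * \<psi> (\<theta> / a t)"
  have "1/2 \<le> cmod (exp ?z)"
    using near[OF th] norm_triangle_ineq2[of 1 "exp ?z"] by (simp add: norm_minus_commute)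
  then have "ln (1/2) \<le> ln (cmod (exp ?z))" by (subst ln_le_cancel_iff) auto
  then have "ln (1/2) \<le> Re ?z" by simp
  moreover have "- ln (1/2) \<le> (1::real)" using ln_le_minus_one[of "2::real"] by (simp add: ln_div)
  ultimately show re: "t * (- Re (\<psi> (\<theta> / a t))) \<le> 1" by simp
  have "\<bar>Im ((\<lambda>r. complex_of_real t * \<psi> (r * \<theta> / a t)) 1)\<bar> < pi / 2"
  proof (rule Im_bound_of_exp_near_one)
    show "continuous_on {0..1} (\<lambda>r. complex_of_real t * \<psi> (r * \<theta> / a t))"
      using a_pos[OF t]
      by (intro continuous_intros continuous_on_compose2[OF psi_continuous]) auto
    show "complex_of_real t * \<psi> (0 * \<theta> / a t) = 0" by (simp add: psi_zero)
    fix r :: real assume r: "0 \<le> r" "r \<le> 1"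
    have "\<bar>r * \<theta>\<bar> \<le> 1 * \<bar>\<theta>\<bar>" unfolding abs_mult using r by (intro mult_right_mono) auto
    then show "cmod (exp (complex_of_real t * \<psi> (r * \<theta> / a t)) - 1) \<le> 1 / 2"
      using th by (intro near) simp
  qed
  then have "\<bar>Im ?z\<bar> \<le> 2" using pi_half_less_two by simp
  moreover have "\<bar>Re ?z\<bar> \<le> 1"
    using re mult_nonneg_nonpos[of t "Re (\<psi> (\<theta> / a t))"] Re_psi_nonpos t by simp
  ultimately have "cmod ?z \<le> 3" using cmod_le[of ?z] by linarith
  then show "t * cmod (\<psi> (\<theta> / a t)) \<le> 3" using t by (simp add: norm_mult)
qed

text \<open>
  A priori, \<open>a\<close> is an arbitrary positive function, so its infimum over \<open>[t0 / 2, t0)\<close> could be \<open>0\<close>.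
  In that case the bound on \<open>\<psi>\<close> would extend to all frequencies: \<open>\<psi>\<close> would be
  bounded, and \<open>t * \<psi> (\<theta> / a t)\<close> would vanish in the limit, against non-triviality.
\<close>

lemma norming_bounded_below:
  assumes t0: "0 < t0" and \<theta>0: "0 < \<theta>0"
    and bd: "\<And>t \<theta>. \<lbrakk>0 < t; t < t0; \<bar>\<theta>\<bar> \<le> \<theta>0\<rbrakk> \<Longrightarrow> t * cmod (\<psi> (\<theta> / a t)) \<le> 3"
  shows "\<exists>c>0. \<forall>t. t0 / 2 \<le> t \<and> t < t0 \<longrightarrow> c \<le> a t"
proof (rule ccontr)
  assume neg: "\<not> ?thesis"
  have psi: "cmod (\<psi> \<theta>) \<le> 6 / t0" for \<theta>
  proof -
    \<comment> \<open>A time at which \<open>a\<close> is so small that \<open>\<bar>\<theta>\<bar> \<le> \<theta>0 / a t\<close>;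
      adding \<open>1\<close> covers \<open>\<theta> = 0\<close>.\<close>
    have "0 < \<theta>0 / (\<bar>\<theta>\<bar> + 1)" using \<theta>0 by (intro divide_pos_pos) auto
    then obtain t where t: "t0 / 2 \<le> t" "t < t0" "a t < \<theta>0 / (\<bar>\<theta>\<bar> + 1)"
      using neg by (meson not_le)
    have tp: "0 < t" using t t0 by simp
    have at: "0 < a t" using a_pos tp by simp
    have "a t * (\<bar>\<theta>\<bar> + 1) < \<theta>0" using t(3) by (subst (asm) pos_less_divide_eq) auto
    then have "\<bar>\<theta> * a t\<bar> \<le> \<theta>0" using at by (simp add: abs_mult algebra_simps)
    from bd[OF tp t(2) this] at have "t * cmod (\<psi> \<theta>) \<le> 3" by simp
    moreover have "t0 / 2 * cmod (\<psi> \<theta>) \<le> t * cmod (\<psi> \<theta>)" using t by (intro mult_right_mono) auto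
    ultimately show ?thesis using t0 by (simp add: field_simps)
  qed
  have z: "(\<lambda>n. inverse (real (Suc n)) * (6 / t0)) \<longlonglongrightarrow> 0"
    using tendsto_mult[OF LIMSEQ_inverse_real_of_nat tendsto_const[of "6 / t0"]] by simp
  show False
  proof (rule exponent_not_vanishing[OF LIMSEQ_inverse_real_of_nat])
    fix \<theta>
    show "(\<lambda>n. complex_of_real (inverse (real (Suc n))) * \<psi> (\<theta> / a (inverse (real (Suc n))))) \<longlonglongrightarrow> 0"
    proof (rule Lim_null_comparison[OF _ z], rule always_eventually, rule allI)
      fix n
      have "cmod (complex_of_real (inverse (real (Suc n))) * \<psi> (\<theta> / a (inverse (real (Suc n)))))
          = inverse (real (Suc n)) * cmod (\<psi> (\<theta> / a (inverse (real (Suc n)))))"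
        unfolding norm_mult norm_of_real by simp
      also have "\<dots> \<le> inverse (real (Suc n)) * (6 / t0)"
        by (intro mult_left_mono psi) simp
      finally show "cmod (complex_of_real (inverse (real (Suc n))) * \<psi> (\<theta> / a (inverse (real (Suc n)))))
          \<le> inverse (real (Suc n)) * (6 / t0)" .
    qed
  qed auto
qed

text \<open>
  The key estimate, by induction on the dyadic scale \<open>t \<ge> t0 / 2 ^ Suc n\<close>. With
  \<open>\<rho> = 2 powr (1 / \<beta>)\<close>, passing from \<open>2 * t\<close> to \<open>t\<close> replaces \<open>\<theta>\<close> by some
  \<open>\<theta>' \<le> \<rho> * \<theta>\<close>; the loss \<open>\<rho> powr \<beta> = 2\<close> is exactly compensated by the factor \<open>1/2\<close> in
  time, so the constant does not deteriorate. If \<open>\<theta>'\<close> leaves the interval \<open>[0, \<theta>0]\<close>, then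
  \<open>\<theta>\<close> is bounded away from \<open>0\<close> and the crude bound \<open>1\<close> on the exponent suffices.
\<close>

lemma exponent_powr_bound:
  assumes \<beta>: "0 < \<beta>" "\<beta> * H < 1"
    and growth: "\<And>L. \<exists>D\<ge>0. \<forall>\<theta>. \<bar>\<theta>\<bar> \<le> L \<longrightarrow> - Re (\<psi> \<theta>) \<le> D * \<bar>\<theta>\<bar> powr \<beta>"
  obtains C \<theta>0 t0 where "0 \<le> C" "0 < \<theta>0" "0 < t0"
    "\<And>t \<theta>. \<lbrakk>0 < t; t < t0; 0 \<le> \<theta>; \<theta> \<le> \<theta>0\<rbrakk> \<Longrightarrow> t * (- Re (\<psi> (\<theta> / a t))) \<le> C * \<theta> powr \<beta>"
    "\<And>t. \<lbrakk>0 < t; t < t0\<rbrakk> \<Longrightarrow> 1/2 \<le> measure (\<mu> t) {x. \<bar>x / a t\<bar> \<le> 1 / \<theta>0}"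
proof -
  define g where "g \<theta> = - Re (\<psi> \<theta>)" for \<theta>
  have g0: "0 \<le> g \<theta>" for \<theta> unfolding g_def using Re_psi_nonpos by simp
  define \<rho> :: real where "\<rho> = 2 powr (1 / \<beta>)"
  have \<rho>0: "0 < \<rho>" unfolding \<rho>_def by simp
  have \<rho>\<beta>: "\<rho> powr \<beta> = 2" unfolding \<rho>_def using \<beta> by (simp add: powr_powr)
  have "2 powr H < \<rho>" unfolding \<rho>_def using \<beta> by (intro powr_less_mono) (auto simp: field_simps)
  from norming_ratio_le[OF _ this] obtain t1 where t1: "0 < t1"
    and ratio: "\<And>t. 0 < t \<Longrightarrow> t < t1 \<Longrightarrow> a (t * 2) \<le> \<rho> * a t"
    unfolding eventually_at_right_field by auto
  obtain \<theta>0 t2 where \<theta>0: "0 < \<theta>0" and t2: "0 < t2"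
    and near: "\<And>t \<theta>. \<lbrakk>0 < t; t < t2; \<bar>\<theta>\<bar> \<le> \<theta>0\<rbrakk> \<Longrightarrow> cmod (exp (complex_of_real t * \<psi> (\<theta> / a t)) - 1) \<le> 1/2"
    and tight: "\<And>t. \<lbrakk>0 < t; t < t2\<rbrakk> \<Longrightarrow> 1/2 \<le> measure (\<mu> t) {x. \<bar>x / a t\<bar> \<le> 1 / \<theta>0}"
    using uniform_tightness by metis
  define t0 where "t0 = min t1 t2"
  have t0: "0 < t0" "t0 \<le> t1" "t0 \<le> t2" unfolding t0_def using t1 t2 by auto
  have near0: "\<And>t \<theta>. \<lbrakk>0 < t; t < t0; \<bar>\<theta>\<bar> \<le> \<theta>0\<rbrakk> \<Longrightarrow> cmod (exp (complex_of_real t * \<psi> (\<theta> / a t)) - 1) \<le> 1/2"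
    using near t0 by auto
  have bd: "t * cmod (\<psi> (\<theta> / a t)) \<le> 3" and bdg: "t * g (\<theta> / a t) \<le> 1"
    if "0 < t" "t < t0" "\<bar>\<theta>\<bar> \<le> \<theta>0" for t \<theta>
    using exponent_bounded_near_zero[OF that(1) near0[OF that(1,2)] that(3)] unfolding g_def by auto
  obtain c where c: "0 < c" "\<And>t. t0 / 2 \<le> t \<Longrightarrow> t < t0 \<Longrightarrow> c \<le> a t"
    using norming_bounded_below[OF t0(1) \<theta>0 bd] by auto
  obtain D where D: "0 \<le> D" "\<And>\<theta>. \<bar>\<theta>\<bar> \<le> \<theta>0 / c \<Longrightarrow> g \<theta> \<le> D * \<bar>\<theta>\<bar> powr \<beta>"
    using growth[of "\<theta>0 / c"] unfolding g_def by auto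
  \<comment> \<open>The first entry starts the induction at the scale \<open>t0\<close>, the second covers frequencies
    that leave the interval \<open>[0, \<theta>0]\<close> after rescaling.\<close>
  define C where "C = max (t0 * (D * c powr (- \<beta>))) ((\<rho> / \<theta>0) powr \<beta>)"
  have C: "t0 * (D * c powr (- \<beta>)) \<le> C" "(\<rho> / \<theta>0) powr \<beta> \<le> C" unfolding C_def by auto
  have C0: "0 \<le> C" using C(2) by (rule order_trans[rotated]) simp
  have dyadic: "\<forall>t \<theta>. 0 < t \<and> t0 / 2 ^ Suc n \<le> t \<and> t < t0 \<and> 0 \<le> \<theta> \<and> \<theta> \<le> \<theta>0 \<longrightarrow>
      t * g (\<theta> / a t) \<le> C * \<theta> powr \<beta>" for n
  proof (induction n)
    case 0
    show ?case
    proof (intro allI impI, elim conjE)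
      fix t \<theta> assume t: "0 < t" "t0 / 2 ^ Suc 0 \<le> t" "t < t0" and th: "0 \<le> \<theta>" "\<theta> \<le> \<theta>0"
      have ca: "c \<le> a t" using c(2)[of t] t by simp
      have at: "0 < a t" using a_pos t by simp
      have "\<theta> / a t \<le> \<theta> / c" using ca c at th by (intro divide_left_mono) auto
      moreover have "\<dots> \<le> \<theta>0 / c" using th c by (intro divide_right_mono) auto
      ultimately have "g (\<theta> / a t) \<le> D * \<bar>\<theta> / a t\<bar> powr \<beta>"
        using th at by (intro D(2)) auto
      also have "\<dots> \<le> D * (\<theta> / c) powr \<beta>"
        using \<open>\<theta> / a t \<le> \<theta> / c\<close> D(1) th at \<beta> by (intro mult_left_mono powr_mono2) auto
      also have "\<dots> = D * c powr (- \<beta>) * \<theta> powr \<beta>"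
        using th c by (simp add: powr_divide powr_minus_divide)
      finally have "g (\<theta> / a t) \<le> D * c powr (- \<beta>) * \<theta> powr \<beta>" .
      then have "t * g (\<theta> / a t) \<le> t0 * (D * c powr (- \<beta>) * \<theta> powr \<beta>)"
        using t g0 t0 by (intro mult_mono) auto
      also have "\<dots> = t0 * (D * c powr (- \<beta>)) * \<theta> powr \<beta>" by simp
      also have "\<dots> \<le> C * \<theta> powr \<beta>" using C(1) by (rule mult_right_mono) auto
      finally show "t * g (\<theta> / a t) \<le> C * \<theta> powr \<beta>" .
    qed
  next
    case (Suc n)
    show ?case
    proof (intro allI impI, elim conjE)
      fix t \<theta> assume t: "0 < t" "t0 / 2 ^ Suc (Suc n) \<le> t" "t < t0" and th: "0 \<le> \<theta>" "\<theta> \<le> \<theta>0"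
      have at: "0 < a t" "0 < a (t * 2)" using a_pos t by auto
      show "t * g (\<theta> / a t) \<le> C * \<theta> powr \<beta>"
      proof (cases "t0 / 2 ^ Suc n \<le> t")
        case True
        then show ?thesis using Suc.IH t th by blast
      next
        case False
        have "t0 / 2 ^ Suc n \<le> t0 / 2" using t0 by (intro divide_left_mono) auto
        then have t2: "t * 2 < t0" using False by simp
        define \<theta>' where "\<theta>' = \<theta> * (a (t * 2) / a t)"
        have th': "0 \<le> \<theta>'" "\<theta>' / a (t * 2) = \<theta> / a t" unfolding \<theta>'_def using th at by auto
        have "a (t * 2) / a t \<le> \<rho>" using ratio[of t] t t0 at by (simp add: field_simps)
        then have le: "\<theta>' \<le> \<theta> * \<rho>" unfolding \<theta>'_def using th by (intro mult_left_mono) auto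
        show ?thesis
        proof (cases "\<theta>' \<le> \<theta>0")
          case True
          have "t * 2 * g (\<theta>' / a (t * 2)) \<le> C * \<theta>' powr \<beta>"
            using Suc.IH[rule_format, of "t * 2" \<theta>'] t t2 th'(1) True by simp
          then have "2 * (t * g (\<theta> / a t)) \<le> C * \<theta>' powr \<beta>" unfolding th' by simp
          also have "\<dots> \<le> C * (\<theta> * \<rho>) powr \<beta>"
            using le th' \<beta> C0 by (intro mult_left_mono powr_mono2) auto
          also have "\<dots> = 2 * (C * \<theta> powr \<beta>)" using th \<rho>0 by (simp add: powr_mult \<rho>\<beta>)
          finally show ?thesis by simp
        next
          case False
          then have "\<theta>0 < \<theta> * \<rho>" using le by simp
          then have "1 \<le> \<rho> / \<theta>0 * \<theta>" using \<theta>0 by (simp add: field_simps)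
          then have "1 \<le> (\<rho> / \<theta>0 * \<theta>) powr \<beta>" using \<beta> by (simp add: ge_one_powr_ge_zero)
          also have "\<dots> = (\<rho> / \<theta>0) powr \<beta> * \<theta> powr \<beta>" using \<theta>0 \<rho>0 th by (subst powr_mult[symmetric]) auto
          also have "\<dots> \<le> C * \<theta> powr \<beta>" using C(2) by (rule mult_right_mono) auto
          finally show ?thesis using bdg[of t \<theta>] t th by simp
        qed
      qed
    qed
  qed
  show ?thesis
  proof (rule that[OF C0 \<theta>0 t0(1)])
    fix t :: real assume t: "0 < t" "t < t0"
    then show "1/2 \<le> measure (\<mu> t) {x. \<bar>x / a t\<bar> \<le> 1 / \<theta>0}" using tight t0 by auto
    fix \<theta> assume th: "0 \<le> \<theta>" "\<theta> \<le> \<theta>0"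
    obtain n where "t0 / t < 2 ^ n" using real_arch_pow[of 2 "t0 / t"] by auto
    also have "(2::real) ^ n \<le> 2 ^ Suc n" by simp
    finally have "t0 / 2 ^ Suc n \<le> t" using t by (simp add: field_simps)
    then show "t * (- Re (\<psi> (\<theta> / a t))) \<le> C * \<theta> powr \<beta>"
      using dyadic[of n] t th unfolding g_def by blast
  qed
qed

text \<open>
  For \<open>s = 1\<close> this combines \<open>exponent_powr_bound\<close> with \<open>moment_bound_from_char\<close>. Other times are
  reduced to \<open>s = 1\<close> by renormalizing with \<open>a (t * s)\<close>, which costs a bounded factor.
\<close>

lemma moments_bounded:
  assumes q: "0 < q" "q < \<beta>" "\<beta> * H < 1"
    and growth: "\<And>L. \<exists>D\<ge>0. \<forall>\<theta>. \<bar>\<theta>\<bar> \<le> L \<longrightarrow> - Re (\<psi> \<theta>) \<le> D * \<bar>\<theta>\<bar> powr \<beta>"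
    and s: "0 < s"
  shows "\<exists>B. \<forall>\<^sub>F t in at_right 0. (\<integral>\<^sup>+x. ennreal (\<bar>x / a t\<bar> powr q) \<partial>\<mu> (t * s)) \<le> ennreal B"
proof -
  have \<beta>: "0 < \<beta>" using q by simp
  obtain C \<theta>0 t0 where C: "0 \<le> C" and \<theta>0: "0 < \<theta>0" and t0: "0 < t0"
    and bound: "\<And>t \<theta>. \<lbrakk>0 < t; t < t0; 0 \<le> \<theta>; \<theta> \<le> \<theta>0\<rbrakk> \<Longrightarrow> t * (- Re (\<psi> (\<theta> / a t))) \<le> C * \<theta> powr \<beta>"
    and tight: "\<And>t. \<lbrakk>0 < t; t < t0\<rbrakk> \<Longrightarrow> 1/2 \<le> measure (\<mu> t) {x. \<bar>x / a t\<bar> \<le> 1 / \<theta>0}"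
    using exponent_powr_bound[OF \<beta> q(3) growth] by metis
  obtain B where B0: "0 \<le> B" and B: "\<And>\<mu>. \<lbrakk>real_distribution \<mu>;
          \<And>\<theta>. \<lbrakk>0 < \<theta>; \<theta> \<le> \<theta>0\<rbrakk> \<Longrightarrow> 1 - (cmod (char \<mu> \<theta>))\<^sup>2 \<le> 2 * C * \<theta> powr \<beta>;
          1/2 \<le> measure \<mu> {x. \<bar>x\<bar> \<le> 1 / \<theta>0}\<rbrakk>
        \<Longrightarrow> (\<integral>\<^sup>+x. ennreal (\<bar>x\<bar> powr q) \<partial>\<mu>) \<le> ennreal B"
    using moment_bound_from_char[OF q(1,2) \<theta>0, of "2 * C" "1 / \<theta>0"] C by auto
  have mom: "(\<integral>\<^sup>+x. ennreal (\<bar>x / a t\<bar> powr q) \<partial>\<mu> t) \<le> ennreal B" if t: "0 < t" "t < t0" for t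
  proof -
    interpret real_distribution "\<mu> t" by (rule mu) (rule t)
    let ?Y = "distr (\<mu> t) borel (\<lambda>x. x / a t)"
    have "(\<integral>\<^sup>+x. ennreal (\<bar>x\<bar> powr q) \<partial>?Y) \<le> ennreal B"
    proof (rule B)
      show "real_distribution ?Y" by simp
      show "1/2 \<le> measure ?Y {x. \<bar>x\<bar> \<le> 1 / \<theta>0}"
        using tight[OF t] by (subst measure_distr) (auto simp: vimage_def)
      fix \<theta> assume th: "0 < \<theta>" "\<theta> \<le> \<theta>0"
      have b: "- (t * Re (\<psi> (\<theta> / a t))) \<le> C * \<theta> powr \<beta>" using bound[OF t, of \<theta>] th by simp
      have "char ?Y \<theta> = char (\<mu> t) (\<theta> / a t)"
        unfolding char_def by (subst integral_distr) auto
      then have "(cmod (char ?Y \<theta>))\<^sup>2 = exp (2 * (t * Re (\<psi> (\<theta> / a t))))"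
        by (simp add: char_mu t exp_double)
      moreover have "1 + 2 * (t * Re (\<psi> (\<theta> / a t))) \<le> exp (2 * (t * Re (\<psi> (\<theta> / a t))))"
        by (rule exp_ge_add_one_self)
      ultimately show "1 - (cmod (char ?Y \<theta>))\<^sup>2 \<le> 2 * C * \<theta> powr \<beta>"
        using b by linarith
    qed
    then show ?thesis by (simp add: nn_integral_distr)
  qed
  define r where "r = s powr H + 1"
  have r: "s powr H < r" "0 < r" unfolding r_def by (auto simp: add_nonneg_pos)
  have "\<forall>\<^sub>F t in at_right 0. t < t0 / s"
    using s t0 unfolding eventually_at_right_field by (intro exI[of _ "t0 / s"]) auto
  then have "\<forall>\<^sub>F t in at_right 0. (\<integral>\<^sup>+x. ennreal (\<bar>x / a t\<bar> powr q) \<partial>\<mu> (t * s)) \<le> ennreal (r powr q * B)"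
    using norming_ratio_le[OF s r(1)] eventually_at_right_less[of 0]
  proof eventually_elim
    case (elim t)
    have ts: "0 < t * s" "t * s < t0" using elim s by (auto simp: field_simps)
    have at: "0 < a t" "0 < a (t * s)" using a_pos ts elim by auto
    interpret real_distribution "\<mu> (t * s)" by (rule mu) (rule ts)
    have "(\<integral>\<^sup>+x. ennreal (\<bar>x / a t\<bar> powr q) \<partial>\<mu> (t * s))
        \<le> (\<integral>\<^sup>+x. ennreal (r powr q) * ennreal (\<bar>x / a (t * s)\<bar> powr q) \<partial>\<mu> (t * s))"
    proof (rule nn_integral_mono)
      fix x
      have "1 / a t \<le> r / a (t * s)" using elim at by (simp add: field_simps)
      then have "\<bar>x\<bar> * (1 / a t) \<le> \<bar>x\<bar> * (r / a (t * s))" by (rule mult_left_mono) auto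
      then have "\<bar>x / a t\<bar> powr q \<le> (r * \<bar>x / a (t * s)\<bar>) powr q"
        using at q by (intro powr_mono2) (auto simp: abs_divide mult.commute)
      then show "ennreal (\<bar>x / a t\<bar> powr q) \<le> ennreal (r powr q) * ennreal (\<bar>x / a (t * s)\<bar> powr q)"
        using r by (subst (asm) powr_mult) (auto simp: ennreal_mult'[symmetric] intro: ennreal_leI)
    qed
    also have "\<dots> \<le> ennreal (r powr q) * ennreal B"
      by (subst nn_integral_cmult, simp, rule mult_left_mono[OF mom[OF ts]], simp)
    finally show ?case using B0 by (simp add: ennreal_mult')
  qed
  then show ?thesis by blast
qed

end

section \<open>Uniform integrability and convergence of moments\<close>

lemma tail_moment_le:
  fixes f :: "'a \<Rightarrow> real"
  assumes q: "0 < q" "q < p" and K: "0 < K"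
    and [measurable]: "f \<in> borel_measurable M"
    and mom: "(\<integral>\<^sup>+\<omega>. ennreal (\<bar>f \<omega>\<bar> powr p) \<partial>M) \<le> ennreal B"
  shows "(\<integral>\<^sup>+\<omega>. ennreal (\<bar>f \<omega>\<bar> powr q) * indicator {\<omega>. K < \<bar>f \<omega>\<bar> powr q} \<omega> \<partial>M)
           \<le> ennreal (K powr (- ((p - q) / q)) * B)"
proof -
  have "(\<integral>\<^sup>+\<omega>. ennreal (\<bar>f \<omega>\<bar> powr q) * indicator {\<omega>. K < \<bar>f \<omega>\<bar> powr q} \<omega> \<partial>M)
      \<le> (\<integral>\<^sup>+\<omega>. ennreal (K powr (- ((p - q) / q))) * ennreal (\<bar>f \<omega>\<bar> powr p) \<partial>M)"
  proof (rule nn_integral_mono)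
    fix \<omega>
    show "ennreal (\<bar>f \<omega>\<bar> powr q) * indicator {\<omega>. K < \<bar>f \<omega>\<bar> powr q} \<omega>
        \<le> ennreal (K powr (- ((p - q) / q))) * ennreal (\<bar>f \<omega>\<bar> powr p)"
    proof (cases "K < \<bar>f \<omega>\<bar> powr q")
      case True
      have "\<bar>f \<omega>\<bar> powr q = (\<bar>f \<omega>\<bar> powr q) powr (- ((p - q) / q)) * \<bar>f \<omega>\<bar> powr p"
        using q by (simp add: powr_powr flip: powr_add)
      also have "\<dots> \<le> K powr (- ((p - q) / q)) * \<bar>f \<omega>\<bar> powr p"
        using True q K by (intro mult_right_mono powr_mono2') (auto simp: divide_nonpos_pos)
      finally show ?thesis using True by (simp add: ennreal_mult'[symmetric] ennreal_leI)
    qed simp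
  qed
  also have "\<dots> \<le> ennreal (K powr (- ((p - q) / q))) * ennreal B"
    by (simp add: nn_integral_cmult mom mult_left_mono)
  also have "\<dots> = ennreal (K powr (- ((p - q) / q)) * B)" by (simp add: ennreal_mult')
  finally show ?thesis .
qed

lemma (in real_distribution) truncated_moment_error:
  assumes q: "0 < q" "q < p" and K: "0 < K" and B: "0 \<le> B"
    and mom: "(\<integral>\<^sup>+x. ennreal (\<bar>x\<bar> powr p) \<partial>M) \<le> ennreal B"
  shows "integrable M (\<lambda>x. \<bar>x\<bar> powr q)"
    and "\<bar>(\<integral>x. \<bar>x\<bar> powr q \<partial>M) - (\<integral>x. min (\<bar>x\<bar> powr q) K \<partial>M)\<bar> \<le> K powr (- ((p - q) / q)) * B"
proof -
  have "integrable M (\<lambda>x. \<bar>x\<bar> powr p)"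
    by (rule integrableI_nonneg) (use mom in \<open>auto intro: le_less_trans\<close>)
  then have ip: "integrable M (\<lambda>x. 1 + \<bar>x\<bar> powr p)" by simp
  show iq: "integrable M (\<lambda>x. \<bar>x\<bar> powr q)"
  proof (rule Bochner_Integration.integrable_bound[OF ip])
    show "AE x in M. norm (\<bar>x\<bar> powr q) \<le> norm (1 + \<bar>x\<bar> powr p)"
    proof (rule AE_I2)
      fix x :: real
      have "\<bar>x\<bar> powr q \<le> 1 + \<bar>x\<bar> powr p"
      proof (cases "\<bar>x\<bar> \<le> 1")
        case True
        then have "\<bar>x\<bar> powr q \<le> 1 powr q" using q by (intro powr_mono2) auto
        then show ?thesis by (simp add: add_increasing2)
      next
        case False
        then have "\<bar>x\<bar> powr q \<le> \<bar>x\<bar> powr p" using q by (intro powr_mono) auto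
        then show ?thesis by simp
      qed
      then show "norm (\<bar>x\<bar> powr q) \<le> norm (1 + \<bar>x\<bar> powr p)" by simp
    qed
  qed simp
  have im: "integrable M (\<lambda>x. min (\<bar>x\<bar> powr q) K)"
    by (rule integrable_const_bound[where B=K]) (use K in auto)
  have it: "integrable M (\<lambda>x. \<bar>x\<bar> powr q * indicator {x. K < \<bar>x\<bar> powr q} x)"
    by (rule integrable_real_mult_indicator) (use iq in auto)
  have "(\<integral>x. \<bar>x\<bar> powr q \<partial>M) - (\<integral>x. min (\<bar>x\<bar> powr q) K \<partial>M) = (\<integral>x. \<bar>x\<bar> powr q - min (\<bar>x\<bar> powr q) K \<partial>M)"
    using iq im by simp
  also have "\<dots> \<le> (\<integral>x. \<bar>x\<bar> powr q * indicator {x. K < \<bar>x\<bar> powr q} x \<partial>M)"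
    by (rule integral_mono) (use iq im it K in \<open>auto simp: indicator_def\<close>)
  also have "\<dots> \<le> K powr (- ((p - q) / q)) * B"
  proof -
    have "ennreal (\<integral>x. \<bar>x\<bar> powr q * indicator {x. K < \<bar>x\<bar> powr q} x \<partial>M)
        = (\<integral>\<^sup>+x. ennreal (\<bar>x\<bar> powr q * indicator {x. K < \<bar>x\<bar> powr q} x) \<partial>M)"
      by (rule nn_integral_eq_integral[symmetric, OF it]) auto
    also have "\<dots> = (\<integral>\<^sup>+x. ennreal (\<bar>x\<bar> powr q) * indicator {x. K < \<bar>x\<bar> powr q} x \<partial>M)"
      by (intro nn_integral_cong) (auto simp: indicator_def)
    also have "\<dots> \<le> ennreal (K powr (- ((p - q) / q)) * B)"
      by (rule tail_moment_le[OF q K _ mom]) simp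
    finally show ?thesis using B by (simp add: ennreal_le_iff)
  qed
  finally have "(\<integral>x. \<bar>x\<bar> powr q \<partial>M) - (\<integral>x. min (\<bar>x\<bar> powr q) K \<partial>M) \<le> K powr (- ((p - q) / q)) * B" .
  moreover have "(\<integral>x. min (\<bar>x\<bar> powr q) K \<partial>M) \<le> (\<integral>x. \<bar>x\<bar> powr q \<partial>M)"
    by (rule integral_mono) (use iq im in auto)
  ultimately show "\<bar>(\<integral>x. \<bar>x\<bar> powr q \<partial>M) - (\<integral>x. min (\<bar>x\<bar> powr q) K \<partial>M)\<bar> \<le> K powr (- ((p - q) / q)) * B"
    by simp
qed

text \<open>
  Weak convergence bounds the truncated moments of the limit, and Fatou's lemma the full moment.
\<close>

lemma moment_le_of_weak_limit:
  assumes F: "F \<noteq> bot" and p: "0 < p" and B: "0 \<le> B"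
    and L: "\<forall>\<^sub>F t in F. real_distribution (L t)" and \<kappa>: "real_distribution \<kappa>"
    and weak: "\<And>f :: real \<Rightarrow> real. continuous_on UNIV f \<Longrightarrow> bounded (range f) \<Longrightarrow>
                 ((\<lambda>t. \<integral>x. f x \<partial>L t) \<longlongrightarrow> (\<integral>x. f x \<partial>\<kappa>)) F"
    and mom: "\<forall>\<^sub>F t in F. (\<integral>\<^sup>+x. ennreal (\<bar>x\<bar> powr p) \<partial>L t) \<le> ennreal B"
  shows "(\<integral>\<^sup>+x. ennreal (\<bar>x\<bar> powr p) \<partial>\<kappa>) \<le> ennreal B"
proof -
  interpret real_distribution \<kappa> by fact
  let ?f = "\<lambda>n x. min (\<bar>x\<bar> powr p) (real n)"
  have trunc: "(\<integral>\<^sup>+x. ennreal (?f n x) \<partial>\<kappa>) \<le> ennreal B" for n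
  proof -
    have "((\<lambda>t. \<integral>x. ?f n x \<partial>L t) \<longlongrightarrow> (\<integral>x. ?f n x \<partial>\<kappa>)) F"
      by (rule weak) (use p in \<open>auto intro!: continuous_intros boundedI[where B="real n"] continuous_on_powr'\<close>)
    moreover have "\<forall>\<^sub>F t in F. (\<integral>x. ?f n x \<partial>L t) \<le> B"
      using L mom
    proof eventually_elim
      case (elim t)
      interpret Lt: real_distribution "L t" by (rule elim)
      have "integrable (L t) (?f n)"
        by (rule Lt.integrable_const_bound[where B="real n"]) auto
      then have "ennreal (\<integral>x. ?f n x \<partial>L t) = (\<integral>\<^sup>+x. ennreal (?f n x) \<partial>L t)"
        by (intro nn_integral_eq_integral[symmetric]) auto
      also have "\<dots> \<le> (\<integral>\<^sup>+x. ennreal (\<bar>x\<bar> powr p) \<partial>L t)"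
        by (intro nn_integral_mono ennreal_leI) simp
      also note elim(2)
      finally show ?case using B by (simp add: ennreal_le_iff)
    qed
    ultimately have "(\<integral>x. ?f n x \<partial>\<kappa>) \<le> B" using F by (rule tendsto_upperbound)
    moreover have "(\<integral>\<^sup>+x. ennreal (?f n x) \<partial>\<kappa>) = ennreal (\<integral>x. ?f n x \<partial>\<kappa>)"
      by (intro nn_integral_eq_integral integrable_const_bound[where B="real n"]) auto
    ultimately show ?thesis by (simp add: ennreal_leI)
  qed
  have "(\<lambda>n. ennreal (?f n x)) \<longlonglongrightarrow> ennreal (\<bar>x\<bar> powr p)" for x
  proof (rule tendsto_eventually)
    obtain k where "\<bar>x\<bar> powr p \<le> real k" using real_arch_simple by blast
    then show "\<forall>\<^sub>F n in sequentially. ennreal (?f n x) = ennreal (\<bar>x\<bar> powr p)"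
      unfolding eventually_sequentially by (intro exI[of _ k]) (auto simp: min_def)
  qed
  then have "(\<integral>\<^sup>+x. ennreal (\<bar>x\<bar> powr p) \<partial>\<kappa>) = (\<integral>\<^sup>+x. liminf (\<lambda>n. ennreal (?f n x)) \<partial>\<kappa>)"
    by (intro nn_integral_cong lim_imp_Liminf[symmetric]) auto
  also have "\<dots> \<le> liminf (\<lambda>n. \<integral>\<^sup>+x. ennreal (?f n x) \<partial>\<kappa>)"
    by (rule nn_integral_liminf) simp
  also have "\<dots> \<le> ennreal B" by (rule Liminf_le) (auto simp: trunc)
  finally show ?thesis .
qed

text \<open>
  Truncating \<open>\<bar>x\<bar> powr q\<close> at level \<open>K\<close> gives a bounded continuous function, for which weak
  convergence applies; the truncation error is uniformly of order \<open>K powr (- ((p - q) / q))\<close>, for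
  the approximating laws and, by \<open>moment_le_of_weak_limit\<close>, also for the limit.
\<close>

lemma moment_convergence:
  assumes F: "F \<noteq> bot" and q: "0 < q" "q < p"
    and L: "\<forall>\<^sub>F t in F. real_distribution (L t)" and \<kappa>: "real_distribution \<kappa>"
    and weak: "\<And>f :: real \<Rightarrow> real. continuous_on UNIV f \<Longrightarrow> bounded (range f) \<Longrightarrow>
                 ((\<lambda>t. \<integral>x. f x \<partial>L t) \<longlongrightarrow> (\<integral>x. f x \<partial>\<kappa>)) F"
    and mom: "\<forall>\<^sub>F t in F. (\<integral>\<^sup>+x. ennreal (\<bar>x\<bar> powr p) \<partial>L t) \<le> ennreal B" and B: "0 \<le> B"
  shows "integrable \<kappa> (\<lambda>x. \<bar>x\<bar> powr q)"
    and "((\<lambda>t. \<integral>x. \<bar>x\<bar> powr q \<partial>L t) \<longlongrightarrow> (\<integral>x. \<bar>x\<bar> powr q \<partial>\<kappa>)) F"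
proof -
  have p: "0 < p" using q by simp
  have mom\<kappa>: "(\<integral>\<^sup>+x. ennreal (\<bar>x\<bar> powr p) \<partial>\<kappa>) \<le> ennreal B"
    by (rule moment_le_of_weak_limit[OF F p B L \<kappa> weak mom])
  show "integrable \<kappa> (\<lambda>x. \<bar>x\<bar> powr q)"
    using real_distribution.truncated_moment_error(1)[OF \<kappa> q zero_less_one B mom\<kappa>] .
  show "((\<lambda>t. \<integral>x. \<bar>x\<bar> powr q \<partial>L t) \<longlongrightarrow> (\<integral>x. \<bar>x\<bar> powr q \<partial>\<kappa>)) F"
  proof (rule tendstoI)
    fix \<epsilon> :: real assume e: "0 < \<epsilon>"
    have "((\<lambda>K. K powr (- ((p - q) / q)) * B) \<longlongrightarrow> 0 * B) at_top"
      by (intro tendsto_intros tendsto_neg_powr filterlim_ident) (use q in auto)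
    then have "\<forall>\<^sub>F K in at_top. K powr (- ((p - q) / q)) * B < \<epsilon> / 3"
      using e by (intro order_tendstoD(2)) auto
    from eventually_conj[OF this eventually_gt_at_top[of 0]]
    obtain K where K: "0 < K" "K powr (- ((p - q) / q)) * B < \<epsilon> / 3"
      unfolding eventually_at_top_linorder by blast
    have "((\<lambda>t. \<integral>x. min (\<bar>x\<bar> powr q) K \<partial>L t) \<longlongrightarrow> (\<integral>x. min (\<bar>x\<bar> powr q) K \<partial>\<kappa>)) F"
      by (rule weak) (use q K in \<open>auto intro!: continuous_intros boundedI[where B=K] continuous_on_powr'\<close>)
    then have "\<forall>\<^sub>F t in F. dist (\<integral>x. min (\<bar>x\<bar> powr q) K \<partial>L t) (\<integral>x. min (\<bar>x\<bar> powr q) K \<partial>\<kappa>) < \<epsilon> / 3"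
      using e by (intro tendstoD) auto
    then show "\<forall>\<^sub>F t in F. dist (\<integral>x. \<bar>x\<bar> powr q \<partial>L t) (\<integral>x. \<bar>x\<bar> powr q \<partial>\<kappa>) < \<epsilon>"
      using L mom
    proof eventually_elim
      case (elim t)
      show ?case
        using elim(1) K(2) real_distribution.truncated_moment_error(2)[OF elim(2) q K(1) B elim(3)]
          real_distribution.truncated_moment_error(2)[OF \<kappa> q K(1) B mom\<kappa>]
        unfolding dist_real_def by linarith
    qed
  qed
qed

lemma uniformly_integrable_of_bounded_moment:
  assumes q: "0 < q" "q < p" and B: "0 \<le> B"
    and meas: "\<And>t. t \<in> T \<Longrightarrow> Z t \<in> borel_measurable M"
    and mom: "\<And>t. t \<in> T \<Longrightarrow> (\<integral>\<^sup>+\<omega>. ennreal (\<bar>Z t \<omega>\<bar> powr p) \<partial>M) \<le> ennreal B"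
  shows "uniformly_integrable M (\<lambda>t \<omega>. \<bar>Z t \<omega>\<bar> powr q) T"
  unfolding uniformly_integrable_def
proof
  show "\<forall>t\<in>T. (\<lambda>\<omega>. \<bar>Z t \<omega>\<bar> powr q) \<in> borel_measurable M" using meas by auto
  have "((\<lambda>K. K powr (- ((p - q) / q)) * B) \<longlongrightarrow> 0 * B) at_top"
    by (intro tendsto_intros tendsto_neg_powr filterlim_ident) (use q in auto)
  then have "((\<lambda>K. ennreal (K powr (- ((p - q) / q)) * B)) \<longlongrightarrow> ennreal 0) at_top"
    by (intro tendsto_ennrealI) simp
  then have lim: "((\<lambda>K. ennreal (K powr (- ((p - q) / q)) * B)) \<longlongrightarrow> 0) at_top" by simp
  show "((\<lambda>K. SUP t\<in>T. \<integral>\<^sup>+\<omega>\<in>{\<omega>. K < \<bar>\<bar>Z t \<omega>\<bar> powr q\<bar>}. ennreal \<bar>\<bar>Z t \<omega>\<bar> powr q\<bar> \<partial>M) \<longlongrightarrow> 0) at_top"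
  proof (rule tendsto_sandwich[OF _ _ tendsto_const lim])
    show "\<forall>\<^sub>F K in at_top. (SUP t\<in>T. \<integral>\<^sup>+\<omega>\<in>{\<omega>. K < \<bar>\<bar>Z t \<omega>\<bar> powr q\<bar>}. ennreal \<bar>\<bar>Z t \<omega>\<bar> powr q\<bar> \<partial>M)
        \<le> ennreal (K powr (- ((p - q) / q)) * B)"
      using eventually_gt_at_top[of 0]
    proof eventually_elim
      case (elim K)
      show ?case using tail_moment_le[OF q elim meas mom] by (intro SUP_least) simp
    qed
  qed simp
qed

section \<open>One-dimensional marginals\<close>

lemma marginal_convergence:
  fixes f :: "real \<Rightarrow> real"
  assumes conv: "fdd_convergence M Y N Z F" and s: "0 \<le> s"
    and Y: "\<forall>\<^sub>F t in F. Y t s \<in> borel_measurable M" and Z: "Z s \<in> borel_measurable N"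
    and f: "continuous_on UNIV f" "bounded (range f)"
  shows "((\<lambda>t. \<integral>\<omega>. f (Y t s \<omega>) \<partial>M) \<longlongrightarrow> (\<integral>\<omega>. f (Z s \<omega>) \<partial>N)) F"
proof -
  have fm [measurable]: "f \<in> borel_measurable borel" using f(1) by (rule borel_measurable_continuous_onI)
  have marg: "(\<integral>x. f (x s) \<partial>fdd P V {s}) = (\<integral>\<omega>. f (V s \<omega>) \<partial>P)" if [measurable]: "V s \<in> borel_measurable P" for P :: "'z measure" and V
  proof -
    have "(\<lambda>\<omega>. \<lambda>t\<in>{s}. V t \<omega>) \<in> measurable P (\<Pi>\<^sub>M t\<in>{s}. borel)"
      by (rule measurable_restrict) (use that in auto)
    moreover have "(\<lambda>x. f (x s)) \<in> borel_measurable (\<Pi>\<^sub>M t\<in>{s}. borel)" by measurable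
    ultimately show ?thesis unfolding fdd_def by (subst integral_distr) auto
  qed
  have "continuous_on ({s} \<rightarrow>\<^sub>E UNIV) (\<lambda>x. f (x s))"
    by (rule continuous_on_compose2[OF f(1)]) (auto intro!: continuous_on_product_coordinates continuous_on_subset[OF continuous_on_product_coordinates])
  moreover have "bounded ((\<lambda>x. f (x s)) ` ({s} \<rightarrow>\<^sub>E UNIV))"
    by (rule bounded_subset[OF f(2)]) auto
  ultimately have "((\<lambda>t. \<integral>x. f (x s) \<partial>fdd M (Y t) {s}) \<longlongrightarrow> (\<integral>x. f (x s) \<partial>fdd N Z {s})) F"
    using conv[unfolded fdd_convergence_def, rule_format, of "{s}" "\<lambda>x. f (x s)"] s by simp
  moreover have "\<forall>\<^sub>F t in F. (\<integral>x. f (x s) \<partial>fdd M (Y t) {s}) = (\<integral>\<omega>. f (Y t s \<omega>) \<partial>M)"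
    using Y by eventually_elim (rule marg)
  ultimately show ?thesis unfolding marg[of Z N, OF Z] by (rule Lim_transform_eventually)
qed

lemma self_similar_marginal:
  assumes ss: "self_similar N Z H" and c: "0 < c"
    and meas: "\<And>t. 0 \<le> t \<Longrightarrow> Z t \<in> borel_measurable N"
  shows "distr N borel (Z c) = distr N borel (\<lambda>\<omega>. c powr H * Z 1 \<omega>)"
proof -
  have marg: "distr (fdd N V {1}) borel (\<lambda>x. x 1) = distr N borel (V 1)" if "V 1 \<in> borel_measurable N" for V :: "real \<Rightarrow> _ \<Rightarrow> real"
  proof -
    have "(\<lambda>\<omega>. \<lambda>t\<in>{1}. V t \<omega>) \<in> measurable N (\<Pi>\<^sub>M t\<in>{1}. borel)"
      by (rule measurable_restrict) (use that in auto)
    moreover have "(\<lambda>x. x 1) \<in> borel_measurable (\<Pi>\<^sub>M t\<in>{1::real}. borel)" by measurable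
    ultimately show ?thesis unfolding fdd_def by (subst distr_distr) (auto simp: comp_def)
  qed
  have "fdd N (\<lambda>t. Z (c * t)) {1} = fdd N (\<lambda>t \<omega>. c powr H * Z t \<omega>) {1}"
    using ss c unfolding self_similar_def same_fdds_def by simp
  then show ?thesis
    using marg[of "\<lambda>t. Z (c * t)"] marg[of "\<lambda>t \<omega>. c powr H * Z t \<omega>"] meas[of c] meas[of 1] c by simp
qed

section \<open>Convergence of absolute moments in the small-time limit\<close>

lemma moment_below_beta_infty:
  assumes \<nu>: "sets \<nu> = sets borel" and q: "0 < q" "ereal q < beta_infty \<nu>" and m: "q < m"
  obtains \<beta> where "q < \<beta>" "\<beta> < m"
    "(\<integral>\<^sup>+x\<in>{x. 1 < \<bar>x\<bar>}. ennreal (\<bar>x\<bar> powr \<beta>) \<partial>\<nu>) < \<infinity>"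
proof -
  obtain \<beta>1 where \<beta>1: "q < \<beta>1" "(\<integral>\<^sup>+x\<in>{x. 1 < \<bar>x\<bar>}. ennreal (\<bar>x\<bar> powr \<beta>1) \<partial>\<nu>) < \<infinity>"
    using q(2) unfolding beta_infty_def less_Sup_iff by auto
  define \<beta> where "\<beta> = min \<beta>1 ((q + m) / 2)"
  have "(\<integral>\<^sup>+x\<in>{x. 1 < \<bar>x\<bar>}. ennreal (\<bar>x\<bar> powr \<beta>) \<partial>\<nu>) \<le> (\<integral>\<^sup>+x\<in>{x. 1 < \<bar>x\<bar>}. ennreal (\<bar>x\<bar> powr \<beta>1) \<partial>\<nu>)"
    by (intro nn_integral_mono) (auto simp: indicator_def \<beta>_def intro!: ennreal_leI powr_mono)
  also note \<beta>1(2)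
  finally show ?thesis using \<beta>1(1) m by (intro that[of \<beta>]) (auto simp: \<beta>_def min_less_iff_disj)
qed

theorem lemma4p1:
  fixes M :: "'a measure" and X :: "real \<Rightarrow> 'a \<Rightarrow> real"
    and N :: "'b measure" and Xhat :: "real \<Rightarrow> 'b \<Rightarrow> real"
    and a :: "real \<Rightarrow> real" and H q :: real and \<nu> :: "real measure"
  assumes "levy_process M X"
    and "levy_process N Xhat"
    and "nontrivial_process N Xhat"
    and "\<And>t. 0 < t \<Longrightarrow> 0 < a t"
    and "(a \<longlongrightarrow> 0) (at_right 0)"
    and "fdd_convergence M (\<lambda>t s \<omega>. X (t * s) \<omega> / a t) N Xhat (at_right 0)"
    and "self_similar N Xhat H"
    and "levy_measure M X \<nu>"
    and "0 < q"
    and "ereal q < min (ereal (1 / H)) (beta_infty \<nu>)"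
  shows "\<forall>s\<ge>0.
      (\<exists>t0>0. uniformly_integrable M (\<lambda>t \<omega>. a t powr (- q) * \<bar>X (t * s) \<omega>\<bar> powr q) {0<..<t0}) \<and>
      integrable N (\<lambda>\<omega>. \<bar>Xhat s \<omega>\<bar> powr q) \<and>
      ((\<lambda>t. a t powr (- q) * (\<integral>\<omega>. \<bar>X (t * s) \<omega>\<bar> powr q \<partial>M)) \<longlongrightarrow>
         (\<integral>\<omega>. \<bar>Xhat s \<omega>\<bar> powr q \<partial>N)) (at_right 0)"
proof -
  interpret X: levy_process M X by fact
  interpret Xhat: levy_process N Xhat by fact
  have meas [measurable]: "0 \<le> t \<Longrightarrow> X t \<in> borel_measurable M" for t by (rule X.measurable_marginals)
  have meas' [measurable]: "0 \<le> t \<Longrightarrow> Xhat t \<in> borel_measurable N" for t by (rule Xhat.measurable_marginals)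
  have weak: "((\<lambda>t. \<integral>\<omega>. f (X (t * s) \<omega> / a t) \<partial>M) \<longlongrightarrow> (\<integral>\<omega>. f (Xhat s \<omega>) \<partial>N)) (at_right 0)"
    if s: "0 \<le> s" and f: "continuous_on UNIV f" "bounded (range f)" for s and f :: "real \<Rightarrow> real"
  proof (rule marginal_convergence[OF assms(6) s _ meas'[OF s] f])
    show "\<forall>\<^sub>F t in at_right 0. (\<lambda>\<omega>. X (t * s) \<omega> / a t) \<in> borel_measurable M"
      using eventually_at_right_less[of 0]
    proof eventually_elim
      case (elim t)
      then have [measurable]: "X (t * s) \<in> borel_measurable M" using s by (intro meas) simp
      show ?case by measurable
    qed
  qed
  have scaling: "distr N borel (Xhat s) = distr N borel (\<lambda>\<omega>. s powr H * Xhat 1 \<omega>)" if "0 < s" for s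
    by (rule self_similar_marginal[OF assms(7) that meas'])
  have [measurable]: "Xhat 1 \<in> borel_measurable N" by (rule meas') simp
  obtain b v where nu: "sets \<nu> = sets borel" "(\<integral>\<^sup>+x. ennreal (min 1 (x\<^sup>2)) \<partial>\<nu>) < \<infinity>" and v: "0 \<le> v"
    and ch: "\<And>t \<theta>. 0 \<le> t \<Longrightarrow> char (distr M borel (X t)) \<theta> = exp (complex_of_real t * levy_exponent b v \<nu> \<theta>)"
    using assms(8) unfolding levy_measure_def levy_exponent_def by blast
  interpret levy_triplet b v \<nu> by standard (use nu v in auto)
  interpret small_time_limit "\<lambda>t. distr M borel (X t)" "distr N borel (Xhat 1)" a H \<psi>
  proof (rule small_time_limit.intro)
    show "real_distribution (distr M borel (X t))" if "0 < t" for t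
      using that by (intro X.real_distribution_distr meas) simp
    show "real_distribution (distr N borel (Xhat 1))" by (rule Xhat.real_distribution_distr) simp
    show "\<not> (AE x in distr N borel (Xhat 1). x = 0)"
    proof
      assume z: "AE x in distr N borel (Xhat 1). x = 0"
      have z1: "AE \<omega> in N. Xhat 1 \<omega> = 0" using z by (subst (asm) AE_distr_iff) auto
      have "AE \<omega> in N. Xhat t \<omega> = 0" if "0 \<le> t" for t
      proof (cases "t = 0")
        case True
        then show ?thesis using Xhat.starts_at_zero by simp
      next
        case False
        then have t: "0 < t" using that by simp
        have [measurable]: "Xhat t \<in> borel_measurable N" using that by (rule meas')
        have "AE x in distr N borel (\<lambda>\<omega>. t powr H * Xhat 1 \<omega>). x = 0"
          using z1 by (subst AE_distr_iff) auto
        then have "AE x in distr N borel (Xhat t). x = 0" unfolding scaling[OF t] .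
        then show ?thesis by (subst (asm) AE_distr_iff) auto
      qed
      then show False using assms(3) unfolding nontrivial_process_def by simp
    qed
    show "0 < t \<Longrightarrow> 0 < a t" for t by (rule assms(4))
    show "((\<lambda>t. \<integral>x. f (x / a t) \<partial>distr M borel (X (t * s))) \<longlongrightarrow>
        (\<integral>x. f (s powr H * x) \<partial>distr N borel (Xhat 1))) (at_right 0)"
      if s: "0 < s" and f: "continuous_on UNIV f" "bounded (range f)" for s and f :: "real \<Rightarrow> real"
    proof -
      have [measurable]: "f \<in> borel_measurable borel" using f(1) by (rule borel_measurable_continuous_onI)
      have [measurable]: "Xhat s \<in> borel_measurable N" using s by (intro meas') simp
      have "(\<integral>\<omega>. f (Xhat s \<omega>) \<partial>N) = (\<integral>x. f x \<partial>distr N borel (Xhat s))"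
        by (rule integral_distr[symmetric]) auto
      also have "\<dots> = (\<integral>x. f (s powr H * x) \<partial>distr N borel (Xhat 1))"
        unfolding scaling[OF s] by (simp add: integral_distr)
      finally have e: "(\<integral>\<omega>. f (Xhat s \<omega>) \<partial>N) = (\<integral>x. f (s powr H * x) \<partial>distr N borel (Xhat 1))" .
      have ev: "\<forall>\<^sub>F t in at_right 0. (\<integral>\<omega>. f (X (t * s) \<omega> / a t) \<partial>M) = (\<integral>x. f (x / a t) \<partial>distr M borel (X (t * s)))"
        using eventually_at_right_less[of 0]
      proof eventually_elim
        case (elim t)
        then have "X (t * s) \<in> borel_measurable M" using s by (intro meas) simp
        then show ?case by (intro integral_distr[symmetric]) auto
      qed
      show ?thesis
        unfolding e[symmetric] by (rule Lim_transform_eventually[OF weak[OF less_imp_le[OF s] f] ev])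
    qed
    show "0 < t \<Longrightarrow> char (distr M borel (X t)) \<theta> = exp (complex_of_real t * \<psi> \<theta>)" for t \<theta>
      by (rule ch) simp
  qed (rule psi_zero continuous_psi psi_quadratic_growth)+
  have H: "1/2 \<le> H" by (rule index_ge_half)
  have qH: "q < 1 / H" and q\<beta>: "ereal q < beta_infty \<nu>" using assms(10) by auto
  obtain \<beta> where \<beta>: "q < \<beta>" "\<beta> < 1 / H"
    and mom\<beta>: "(\<integral>\<^sup>+x\<in>{x. 1 < \<bar>x\<bar>}. ennreal (\<bar>x\<bar> powr \<beta>) \<partial>\<nu>) < \<infinity>"
    by (rule moment_below_beta_infty[OF nu(1) assms(9) q\<beta> qH])
  have \<beta>H: "\<beta> * H < 1" using \<beta> H by (simp add: field_simps)
  have "1 / H \<le> 2" using H by (simp add: field_simps)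
  then have \<beta>2: "0 < \<beta>" "\<beta> \<le> 2" using \<beta> assms(9) by auto
  have growth: "\<exists>D\<ge>0. \<forall>\<theta>. \<bar>\<theta>\<bar> \<le> L \<longrightarrow> - Re (\<psi> \<theta>) \<le> D * \<bar>\<theta>\<bar> powr \<beta>" for L
    by (rule Re_psi_powr_bound[OF \<beta>2 mom\<beta>])
  \<comment> \<open>Two margins are needed: from \<open>\<beta>\<close> to \<open>p\<close> for summing the dyadic series, and from \<open>p\<close>
    to \<open>q\<close> for uniform integrability.\<close>
  define p where "p = (q + \<beta>) / 2"
  have p: "q < p" "p < \<beta>" "0 < p" unfolding p_def using \<beta> assms(9) by auto
  show ?thesis
  proof (intro allI impI)
    fix s :: real assume s: "0 \<le> s"
    have msr: "X (t * s) \<in> borel_measurable M" if "0 < t" for t using s that by (intro meas) simp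
    have [measurable]: "Xhat s \<in> borel_measurable N" using s by (rule meas')
    have norm: "a t powr (- q) * \<bar>x\<bar> powr q = \<bar>x / a t\<bar> powr q" if "0 < t" for t x
      using assms(4)[OF that] by (simp add: abs_divide powr_divide powr_minus_divide)
    obtain B where B: "\<forall>\<^sub>F t in at_right 0. (\<integral>\<^sup>+\<omega>. ennreal (\<bar>X (t * s) \<omega> / a t\<bar> powr p) \<partial>M) \<le> ennreal B"
    proof (cases "s = 0")
      case True
      have "(\<integral>\<^sup>+\<omega>. ennreal (\<bar>X (t * s) \<omega> / a t\<bar> powr p) \<partial>M) = (\<integral>\<^sup>+\<omega>. 0 \<partial>M)" for t
        using X.starts_at_zero True by (intro nn_integral_cong_AE) auto
      then show ?thesis using that[of 0] by simp
    next
      case False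
      then have "0 < s" using s by simp
      from moments_bounded[OF p(3,2) \<beta>H growth this]
      obtain B where B: "\<forall>\<^sub>F t in at_right 0. (\<integral>\<^sup>+x. ennreal (\<bar>x / a t\<bar> powr p) \<partial>distr M borel (X (t * s))) \<le> ennreal B"
        by blast
      show ?thesis
      proof (rule that[of B])
        show "\<forall>\<^sub>F t in at_right 0. (\<integral>\<^sup>+\<omega>. ennreal (\<bar>X (t * s) \<omega> / a t\<bar> powr p) \<partial>M) \<le> ennreal B"
          using B eventually_at_right_less[of 0]
          by eventually_elim (simp add: nn_integral_distr msr)
      qed
    qed
    have B': "\<forall>\<^sub>F t in at_right 0. (\<integral>\<^sup>+\<omega>. ennreal (\<bar>X (t * s) \<omega> / a t\<bar> powr p) \<partial>M) \<le> ennreal (max B 0)"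
      using B by eventually_elim (auto intro: order_trans ennreal_leI)
    obtain t0 where t0: "0 < t0" "\<And>t. 0 < t \<Longrightarrow> t < t0 \<Longrightarrow>
        (\<integral>\<^sup>+\<omega>. ennreal (\<bar>X (t * s) \<omega> / a t\<bar> powr p) \<partial>M) \<le> ennreal (max B 0)"
      using B' unfolding eventually_at_right_field by auto
    have "uniformly_integrable M (\<lambda>t \<omega>. \<bar>X (t * s) \<omega> / a t\<bar> powr q) {0<..<t0}"
      by (rule uniformly_integrable_of_bounded_moment[OF assms(9) p(1), where B="max B 0"])
         (use t0 msr in auto)
    moreover have "uniformly_integrable M (\<lambda>t \<omega>. \<bar>X (t * s) \<omega> / a t\<bar> powr q) {0<..<t0} =
        uniformly_integrable M (\<lambda>t \<omega>. a t powr (- q) * \<bar>X (t * s) \<omega>\<bar> powr q) {0<..<t0}"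
      unfolding uniformly_integrable_def
      by (intro arg_cong2[where f="(\<and>)"] ball_cong refl arg_cong3[where f=filterlim] ext SUP_cong) (simp_all add: norm)
    ultimately have ui: "\<exists>t0>0. uniformly_integrable M (\<lambda>t \<omega>. a t powr (- q) * \<bar>X (t * s) \<omega>\<bar> powr q) {0<..<t0}"
      using t0(1) by blast
    let ?L = "\<lambda>t. distr M borel (\<lambda>\<omega>. X (t * s) \<omega> / a t)"
    have pos: "\<forall>\<^sub>F t::real in at_right 0. 0 < t" by (rule eventually_at_right_less)
    have L: "\<forall>\<^sub>F t in at_right 0. real_distribution (?L t)"
      using pos by eventually_elim (use msr in \<open>auto intro!: X.real_distribution_distr\<close>)
    have K: "real_distribution (distr N borel (Xhat s))" by (rule Xhat.real_distribution_distr) simp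
    have weakL: "((\<lambda>t. \<integral>x. f x \<partial>?L t) \<longlongrightarrow> (\<integral>x. f x \<partial>distr N borel (Xhat s))) (at_right 0)"
      if f: "continuous_on UNIV f" "bounded (range f)" for f :: "real \<Rightarrow> real"
    proof -
      have [measurable]: "f \<in> borel_measurable borel" using f(1) by (rule borel_measurable_continuous_onI)
      have ev: "\<forall>\<^sub>F t in at_right 0. (\<integral>\<omega>. f (X (t * s) \<omega> / a t) \<partial>M) = (\<integral>x. f x \<partial>?L t)"
        using pos by eventually_elim (use msr in \<open>auto intro!: integral_distr[symmetric]\<close>)
      have e: "(\<integral>x. f x \<partial>distr N borel (Xhat s)) = (\<integral>\<omega>. f (Xhat s \<omega>) \<partial>N)"
        by (rule integral_distr) auto
      show ?thesis unfolding e by (rule Lim_transform_eventually[OF weak[OF s f] ev])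
    qed
    have momL: "\<forall>\<^sub>F t in at_right 0. (\<integral>\<^sup>+x. ennreal (\<bar>x\<bar> powr p) \<partial>?L t) \<le> ennreal (max B 0)"
      using B' pos
    proof eventually_elim
      case (elim t)
      have "(\<integral>\<^sup>+x. ennreal (\<bar>x\<bar> powr p) \<partial>?L t) = (\<integral>\<^sup>+\<omega>. ennreal (\<bar>X (t * s) \<omega> / a t\<bar> powr p) \<partial>M)"
        using msr[OF elim(2)] by (intro nn_integral_distr) auto
      with elim(1) show ?case by (simp only:)
    qed
    have B0: "0 \<le> max B 0" by simp
    have "integrable (distr N borel (Xhat s)) (\<lambda>x. \<bar>x\<bar> powr q)"
      by (rule moment_convergence(1)[OF trivial_limit_at_right_real assms(9) p(1) L K weakL momL B0])
    then have int: "integrable N (\<lambda>\<omega>. \<bar>Xhat s \<omega>\<bar> powr q)"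
      by (subst (asm) integrable_distr_eq) auto
    have conv: "((\<lambda>t. \<integral>x. \<bar>x\<bar> powr q \<partial>?L t) \<longlongrightarrow> (\<integral>x. \<bar>x\<bar> powr q \<partial>distr N borel (Xhat s))) (at_right 0)"
      by (rule moment_convergence(2)[OF trivial_limit_at_right_real assms(9) p(1) L K weakL momL B0])
    have "\<forall>\<^sub>F t in at_right 0. (\<integral>x. \<bar>x\<bar> powr q \<partial>?L t) = a t powr (- q) * (\<integral>\<omega>. \<bar>X (t * s) \<omega>\<bar> powr q \<partial>M)"
      using pos
    proof eventually_elim
      case (elim t)
      have "(\<integral>x. \<bar>x\<bar> powr q \<partial>?L t) = (\<integral>\<omega>. \<bar>X (t * s) \<omega> / a t\<bar> powr q \<partial>M)"
        using msr[OF elim] by (intro integral_distr) auto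
      also have "\<dots> = (\<integral>\<omega>. a t powr (- q) * \<bar>X (t * s) \<omega>\<bar> powr q \<partial>M)"
        using norm[OF elim] by simp
      finally show ?case by simp
    qed
    then have "((\<lambda>t. a t powr (- q) * (\<integral>\<omega>. \<bar>X (t * s) \<omega>\<bar> powr q \<partial>M)) \<longlongrightarrow> (\<integral>x. \<bar>x\<bar> powr q \<partial>distr N borel (Xhat s))) (at_right 0)"
      by (rule Lim_transform_eventually[OF conv])
    also have "(\<integral>x. \<bar>x\<bar> powr q \<partial>distr N borel (Xhat s)) = (\<integral>\<omega>. \<bar>Xhat s \<omega>\<bar> powr q \<partial>N)"
      by (rule integral_distr) auto
    finally show "(\<exists>t0>0. uniformly_integrable M (\<lambda>t \<omega>. a t powr (- q) * \<bar>X (t * s) \<omega>\<bar> powr q) {0<..<t0}) \<and>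
      integrable N (\<lambda>\<omega>. \<bar>Xhat s \<omega>\<bar> powr q) \<and>
      ((\<lambda>t. a t powr (- q) * (\<integral>\<omega>. \<bar>X (t * s) \<omega>\<bar> powr q \<partial>M)) \<longlongrightarrow>
         (\<integral>\<omega>. \<bar>Xhat s \<omega>\<bar> powr q \<partial>N)) (at_right 0)"
      using ui int by simp
  qed
qed

end
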